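(* Let $\mathcal A$ be an algebraic hyperbolic MCRS-group in $GL(2,\mathbb R)$. Then there exists a positive constant $C$ such that for every positive integer $N$ the following holds: if the best approximation $\mathcal A_N\in\mathrm{Rat}_2$ of $\mathcal A$ of size not exceeding $N$ is defined by primitive vectors $v_1$ and $v_2$ (i.e. its eigenspaces are spanned by $v_1$ and $v_2$) contained in the $k_1$-geometric and $k_2$-geometric continued fractions of $\mathcal A$ respectively, then $k_1<C$ and $k_2<C$.
   Context: Let $I^2=-1$. A real operator on $\mathbb R^2$ (with a fixed basis, coordinates $(x,y)$) is regular if its eigenvalues are distinct (not necessarily real). An MCRS-group is a maximal commutative subgroup of $GL(2,\mathbb R)$ containing a regular operator. Its eigenspaces are the two distinct one-dimensional complex subspaces $l_1,l_2$ of $\mathbb C^2$ that are eigenspaces of any of its regular operators; they determine the group. An MCRS-group is hyperbolic if it contains an operator with real, pairwise distinct eigenvalues (so its eigenspaces are real lines); it is algebraic if it contains a regular operator belonging to $GL(2,\mathbb Z)$. Markoff-Davenport form: let $L_i$ be a nonzero linear form on $\mathbb C^2$ vanishing on $l_j$, $j\neq i$. Put $\Phi_{\mathcal A}(x,y)=L_1(x,y)L_2(x,y)/\Delta(L_1,L_2)$, where $\Delta(L_1,L_2)$ is the determinant of the matrix whose $k$-th column consists of the coefficients of $L_k$. It is determined by $\mathcal A$ up to sign. Discrepancy: for MCRS-groups $\mathcal A_1,\mathcal A_2$, take the maximal absolute value (complex modulus) of the coefficients of the quadratic form $\Phi_{\mathcal A_1}+\Phi_{\mathcal A_2}$, and likewise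 of $\Phi_{\mathcal A_1}-\Phi_{\mathcal A_2}$; $\rho(\mathcal A_1,\mathcal A_2)$ is the smaller of these two numbers. Rational groups and size: a Gaussian vector is a vector with coordinates in $\mathbb Z[I]$; it is primitive if its coordinates are relatively prime. An MCRS-group is rational if both its eigenspaces contain nonzero Gaussian vectors; $\mathrm{Rat}_2$ is the set of all rational MCRS-groups in $GL(2,\mathbb R)$. For $v=(v_1,v_2)\in\mathbb C^2$ put $|v|=\max(|v_1|,|v_2|)$. The size $\nu(\mathcal A)$ of a rational MCRS-group is $\max(|v_1|,|v_2|)$, where $v_i$ is a primitive Gaussian vector in the eigenspace $l_i$. Best approximation: for a positive integer $N$, $\mathcal A_N$ denotes a group in $\mathrm{Rat}_2$ with $\nu(\mathcal A_N)\le N$ and $\rho(\mathcal A,\mathcal A_N)=\min\{\rho(\mathcal A,\mathcal A'):\mathcal A'\in\mathrm{Rat}_2,\ \nu(\mathcal A')\le N\}$. Sails: let a cone in $\mathbb R^2$ have vertex at the origin and boundary rays $r_1,r_2$ forming an angle strictly between $0$ and $\pi$. Let $I_{r_1,r_2}$ be the set of all integer points of the closed cone except the origin. The $1$-sail (sail) of the cone is the boundary of the convex hull of $I_{r_1,r_2}$; inductively, the $k_0$-sail is the boundary of the convex hull of $I_{r_1,r_2}\setminus\bigcup_{k=1}^{k_0-1}(k\text{-sail})$. For a hyperbolic MCRS-group with eigenlines $l_1,l_2\subset\mathbb R^2$, its $k$-geometric continued fraction ($k$ a positive integer) is the union of the $k$-sails of the four cones into which $l_1$ and $l_2$ divide the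 plane. *)

theory Defs
  imports "HOL-Analysis.Analysis" "HOL-Algebra.Group"
begin

definition GL2R :: "(real^2^2) monoid" where
  "GL2R = \<lparr>carrier = {M. invertible M}, monoid.mult = (**), one = mat 1\<rparr>"

lemma group_GL2R: "group GL2R"
proof (rule groupI)
  fix M assume "M \<in> carrier GL2R"
  then obtain M' where "M ** M' = mat 1" "M' ** M = mat 1"
    by (auto simp: GL2R_def invertible_def)
  then show "\<exists>M'\<in>carrier GL2R. M' \<otimes>\<^bsub>GL2R\<^esub> M = \<one>\<^bsub>GL2R\<^esub>"
    by (auto simp: GL2R_def invertible_def)
next
  show "\<one>\<^bsub>GL2R\<^esub> \<in> carrier GL2R"
    by (auto simp: GL2R_def invertible_def intro: exI[of _ "mat 1"])
qed (auto simp: GL2R_def invertible_mult matrix_mul_assoc)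

definition GL2Z :: "(real^2^2) set" where
  "GL2Z = {M. invertible M \<and> (\<forall>i j. M $ i $ j \<in> \<int> \<and> matrix_inv M $ i $ j \<in> \<int>)}"

definition commutative_subgroup :: "(real^2^2) set \<Rightarrow> bool" where
  "commutative_subgroup \<A> \<longleftrightarrow>
     subgroup \<A> GL2R \<and> (\<forall>M\<in>\<A>. \<forall>M'\<in>\<A>. M ** M' = M' ** M)"

definition eigenspace :: "real^2^2 \<Rightarrow> complex \<Rightarrow> (complex^2) set" where
  "eigenspace M c = {v. map_matrix complex_of_real M *v v = c *s v}"

definition eigenvalues :: "real^2^2 \<Rightarrow> complex set" where
  "eigenvalues M = {c. \<exists>v\<in>eigenspace M c. v \<noteq> 0}"

definition regular :: "real^2^2 \<Rightarrow> bool" where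
  "regular M \<longleftrightarrow> card (eigenvalues M) = 2"

definition MCRS_group :: "(real^2^2) set \<Rightarrow> bool" where
  "MCRS_group \<A> \<longleftrightarrow>
     commutative_subgroup \<A> \<and>
     (\<forall>\<B>. commutative_subgroup \<B> \<and> \<A> \<subseteq> \<B> \<longrightarrow> \<B> = \<A>) \<and>
     (\<exists>M\<in>\<A>. regular M)"

text \<open>
  The eigenspaces of an MCRS-group form an unordered pair, so the following
  relation is symmetric in \<open>l1\<close> and \<open>l2\<close>.
\<close>

definition has_eigenspaces ::
    "(real^2^2) set \<Rightarrow> (complex^2) set \<Rightarrow> (complex^2) set \<Rightarrow> bool" where
  "has_eigenspaces \<A> l1 l2 \<longleftrightarrow>
     l1 \<noteq> l2 \<and> (\<forall>M\<in>\<A>. regular M \<longrightarrow> eigenspace M ` eigenvalues M = {l1, l2})"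

definition hyperbolic :: "(real^2^2) set \<Rightarrow> bool" where
  "hyperbolic \<A> \<longleftrightarrow> (\<exists>M\<in>\<A>. regular M \<and> eigenvalues M \<subseteq> \<real>)"

definition algebraic_group :: "(real^2^2) set \<Rightarrow> bool" where
  "algebraic_group \<A> \<longleftrightarrow> (\<exists>M\<in>\<A>. regular M \<and> M \<in> GL2Z)"

definition max_abs :: "complex^'n \<Rightarrow> real" where
  "max_abs v = (MAX i. norm (v $ i))"

text \<open>
  A linear form \<open>a x + b y\<close> is represented by its coefficient vector \<open>(a, b)\<close>, and a
  quadratic form \<open>p x\<^sup>2 + q x y + r y\<^sup>2\<close> by its coefficient vector \<open>(p, q, r)\<close>.
\<close>

definition linear_form :: "complex^2 \<Rightarrow> complex^2 \<Rightarrow> complex" where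
  "linear_form L v = L $ 1 * v $ 1 + L $ 2 * v $ 2"

definition quadratic_form :: "complex^3 \<Rightarrow> complex^2 \<Rightarrow> complex" where
  "quadratic_form \<Phi> v =
     \<Phi> $ 1 * (v $ 1)^2 + \<Phi> $ 2 * (v $ 1 * v $ 2) + \<Phi> $ 3 * (v $ 2)^2"

definition form_product :: "complex^2 \<Rightarrow> complex^2 \<Rightarrow> complex^3" where
  "form_product L1 L2 =
     vector [L1 $ 1 * L2 $ 1, L1 $ 1 * L2 $ 2 + L1 $ 2 * L2 $ 1, L1 $ 2 * L2 $ 2]"

lemma quadratic_form_product:
  "quadratic_form (form_product L1 L2) v = linear_form L1 v * linear_form L2 v"
  by (simp add: quadratic_form_def form_product_def linear_form_def algebra_simps
      power2_eq_square)

definition form_det :: "complex^2 \<Rightarrow> complex^2 \<Rightarrow> complex" where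
  "form_det L1 L2 = det (transpose (vector [L1, L2] :: complex^2^2))"

lemma form_det_eq: "form_det L1 L2 = L1 $ 1 * L2 $ 2 - L2 $ 1 * L1 $ 2"
  by (simp add: form_det_def det_2 transpose_def)

text \<open>
  The form is determined only up to sign, so this is a relation. The minimum over both signs
  makes the discrepancy below independent of the forms chosen.
\<close>

definition is_Markoff_Davenport_form :: "(real^2^2) set \<Rightarrow> complex^3 \<Rightarrow> bool" where
  "is_Markoff_Davenport_form \<A> \<Phi> \<longleftrightarrow>
     (\<exists>l1 l2 L1 L2. has_eigenspaces \<A> l1 l2 \<and> L1 \<noteq> 0 \<and> L2 \<noteq> 0 \<and>
        (\<forall>v\<in>l2. linear_form L1 v = 0) \<and> (\<forall>v\<in>l1. linear_form L2 v = 0) \<and>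
        \<Phi> = inverse (form_det L1 L2) *s form_product L1 L2)"

definition discrepancy :: "(real^2^2) set \<Rightarrow> (real^2^2) set \<Rightarrow> real" where
  "discrepancy \<A>1 \<A>2 =
     (THE r. \<exists>\<Phi>1 \<Phi>2. is_Markoff_Davenport_form \<A>1 \<Phi>1 \<and> is_Markoff_Davenport_form \<A>2 \<Phi>2 \<and>
        r = min (max_abs (\<Phi>1 + \<Phi>2)) (max_abs (\<Phi>1 - \<Phi>2)))"

definition gaussian_integers :: "complex set" where
  "gaussian_integers = {z. Re z \<in> \<int> \<and> Im z \<in> \<int>}"

definition gaussian_vector :: "complex^2 \<Rightarrow> bool" where
  "gaussian_vector v \<longleftrightarrow> (\<forall>i. v $ i \<in> gaussian_integers)"

text \<open>Relatively prime coordinates: every common divisor in the Gaussian integers is a unit.\<close>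

definition primitive :: "complex^2 \<Rightarrow> bool" where
  "primitive v \<longleftrightarrow> gaussian_vector v \<and>
     (\<forall>d\<in>gaussian_integers.
        (\<forall>i. \<exists>a\<in>gaussian_integers. v $ i = d * a) \<longrightarrow>
        (\<exists>u\<in>gaussian_integers. d * u = 1))"

definition Rat2 :: "(real^2^2) set set" where
  "Rat2 = {\<A>. MCRS_group \<A> \<and>
     (\<exists>l1 l2. has_eigenspaces \<A> l1 l2 \<and>
        (\<exists>v\<in>l1. v \<noteq> 0 \<and> gaussian_vector v) \<and> (\<exists>v\<in>l2. v \<noteq> 0 \<and> gaussian_vector v))}"

text \<open>
  Primitive vectors in an eigenspace are unique up to Gaussian units, so the size of a rational
  group is well defined.
\<close>

definition group_size :: "(real^2^2) set \<Rightarrow> real" where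
  "group_size \<A> =
     (THE r. \<exists>l1 l2 v1 v2. has_eigenspaces \<A> l1 l2 \<and>
        v1 \<in> l1 \<and> primitive v1 \<and> v2 \<in> l2 \<and> primitive v2 \<and>
        r = max (max_abs v1) (max_abs v2))"

text \<open>Best approximations need not be unique, so this is again a relation.\<close>

definition best_approximation :: "(real^2^2) set \<Rightarrow> nat \<Rightarrow> (real^2^2) set \<Rightarrow> bool" where
  "best_approximation \<A> N \<B> \<longleftrightarrow>
     \<B> \<in> Rat2 \<and> group_size \<B> \<le> real N \<and>
     (\<forall>\<B>'\<in>Rat2. group_size \<B>' \<le> real N \<longrightarrow> discrepancy \<A> \<B> \<le> discrepancy \<A> \<B>')"

definition complexify :: "real^2 \<Rightarrow> complex^2" where
  "complexify w = (\<chi> i. complex_of_real (w $ i))"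

definition integer_points :: "(real^2) set \<Rightarrow> (real^2) set" where
  "integer_points K = {w\<in>K. w \<noteq> 0 \<and> (\<forall>i. w $ i \<in> \<int>)}"

text \<open>Sails are numbered from 1; the value at \<open>k = 0\<close> has no meaning.\<close>

function sail :: "(real^2) set \<Rightarrow> nat \<Rightarrow> (real^2) set" where
  "sail K k = frontier (convex hull (integer_points K - (\<Union>j\<in>{1..<k}. sail K j)))"
  by pat_completeness auto
termination by (relation "inv_image less_than snd") auto

declare sail.simps [simp del]

definition closed_cone :: "real^2 \<Rightarrow> real^2 \<Rightarrow> (real^2) set" where
  "closed_cone u1 u2 = {a *\<^sub>R u1 + b *\<^sub>R u2 |a b. 0 \<le> a \<and> 0 \<le> b}"

text \<open>
  For a hyperbolic group the vectors \<open>u1\<close> and \<open>u2\<close> below run through all nonzero vectors of its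
  two real eigenlines; positive rescaling does not change the cone, so the four choices of signs
  give exactly the four cones into which the eigenlines divide the plane.
\<close>

definition eigencones :: "(real^2^2) set \<Rightarrow> (real^2) set set" where
  "eigencones \<A> = {closed_cone u1 u2 |u1 u2. u1 \<noteq> 0 \<and> u2 \<noteq> 0 \<and>
     has_eigenspaces \<A> (vec.span {complexify u1}) (vec.span {complexify u2})}"

definition geometric_continued_fraction :: "(real^2^2) set \<Rightarrow> nat \<Rightarrow> (real^2) set" where
  "geometric_continued_fraction \<A> k = (\<Union>K\<in>eigencones \<A>. sail K k)"

end

theory Submission
  imports Defs
begin

text \<open>
  Let \<open>u1\<close>, \<open>u2\<close> be real vectors on the eigenlines of \<open>\<A>\<close>, and let \<open>\<Phi>\<close> be its Markoff-Davenport form,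
  so that \<open>\<Phi> w = cross u1 w * cross u2 w / cross u1 u2\<close> on real vectors, where \<open>cross\<close> is the
  two-dimensional determinant. Two facts, one on approximation and one on sails, meet in the
  quantity \<open>\<bar>\<Phi> v\<bar>\<close>.

  Approximation: if \<open>\<A>\<^sub>N\<close> has eigenvectors \<open>v1\<close> and \<open>v2\<close>, then its own form vanishes at \<open>v1\<close> and
  \<open>v2\<close>. Hence \<open>\<Phi>\<close> takes at \<open>v1\<close> the same value as \<open>\<Phi> \<plusminus> \<Phi>\<^sub>N\<close>, and so
  \<open>\<bar>\<Phi> v1\<bar> \<le> 3 * \<rho>(\<A>, \<A>\<^sub>N) * \<bar>v1\<bar>\<^sup>2 \<le> 3 * \<rho>(\<A>, \<A>\<^sub>N) * N\<^sup>2\<close> (\<open>MD_value_le_discrepancy\<close>). It suffices to exhibit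
  one rational group of size at most \<open>N\<close> at distance \<open>O(1/N\<^sup>2)\<close> from \<open>\<A>\<close>. By Dirichlet's theorem there
  are primitive integer vectors \<open>w1\<close>, \<open>w2\<close> of size at most \<open>N\<close> with \<open>\<bar>cross u\<^sub>i w\<^sub>i\<bar> = O(1/N)\<close>. If \<open>\<bar>\<Phi>\<bar>\<close>
  is bounded below by a positive constant on nonzero integer vectors, then their other coordinate
  has order \<open>N\<close>, so the directions of \<open>w\<^sub>i\<close> and \<open>u\<^sub>i\<close> differ by \<open>O(1/N\<^sup>2)\<close>, and the
  forms differ by the same order (\<open>good_rational_approximation\<close>).

  Sails: a point \<open>v\<close> of the \<open>k\<close>-th sail of a cone lies so deep that each linear functional \<open>h\<close> with finite
  sublevel sets on the integer points of the cone takes values not much larger than \<open>h v\<close>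
  at no fewer than \<open>k\<close> integer points: the minimiser of \<open>h\<close> at each level lies on the
  sail of that level (\<open>sail_depth_le_card\<close>). With \<open>h\<close> adapted to \<open>v\<close>, these points lie in a box around the
  origin whose area is a constant times \<open>\<bar>\<Phi> v\<bar>\<close>. As \<open>\<bar>\<Phi>\<bar>\<close> is bounded below on
  differences of integer points, the pigeonhole principle bounds their number in terms of \<open>\<bar>\<Phi> v\<bar>\<close>
  (\<open>sail_depth_bounded_by_form\<close>).

  Algebraicity enters through the lower bound. For a regular integer matrix \<open>M \<in> \<A>\<close> with
  eigenvalues \<open>a\<close>, \<open>b\<close> we have \<open>cross w (M w) = (a - b) * \<Phi> w\<close>, which is an integer for integer \<open>w\<close>. So either
  \<open>\<bar>\<Phi> w\<bar> \<ge> 1 / \<bar>a - b\<bar>\<close> for all nonzero integer \<open>w\<close>, or an eigenline contains an integer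
  vector, and then so does the other (\<open>integer_form_dichotomy\<close>). In the second case \<open>\<A>\<close> is itself
  rational. As soon as \<open>N\<close> reaches its size, \<open>\<rho>(\<A>, \<A>\<^sub>N) = 0\<close>, which forces \<open>v1\<close> and \<open>v2\<close> onto the
  eigenlines of \<open>\<A>\<close>. All eigenvectors in question are therefore bounded, and so is their depth
  (\<open>sail_depth_bounded_on_bounded_sets\<close>).
\<close>

section \<open>Depth of sails\<close>

definition level_points :: "(real^2) set \<Rightarrow> nat \<Rightarrow> (real^2) set" where
  "level_points K k = integer_points K - (\<Union>j\<in>{1..<k}. sail K j)"

lemma sail_eq_frontier: "sail K k = frontier (convex hull (level_points K k))"
  by (simp add: level_points_def sail.simps[of K k])

lemma level_points_antimono: "i \<le> j \<Longrightarrow> level_points K j \<subseteq> level_points K i"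
  by (force simp: level_points_def)

text \<open>
  The convex hull lies in the halfspace \<open>h \<bullet> x \<ge> h \<bullet> w\<close>, whose interior misses \<open>w\<close>.
\<close>
lemma minimizer_in_sail:
  assumes w: "w \<in> level_points K k" and h: "h \<noteq> 0"
    and min: "\<And>x. x \<in> level_points K k \<Longrightarrow> h \<bullet> w \<le> h \<bullet> x"
  shows "w \<in> sail K k"
proof -
  have sub: "convex hull (level_points K k) \<subseteq> {x. h \<bullet> x \<ge> h \<bullet> w}"
    by (rule hull_minimal) (auto simp: min convex_halfspace_ge)
  have "interior (convex hull (level_points K k)) \<subseteq> interior {x. h \<bullet> x \<ge> h \<bullet> w}"
    by (rule interior_mono[OF sub])
  also have "\<dots> = {x. h \<bullet> x > h \<bullet> w}"
    using h by (rule interior_halfspace_ge)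
  finally have "w \<notin> interior (convex hull (level_points K k))" by auto
  moreover have "w \<in> closure (convex hull (level_points K k))"
    using w by (meson closure_subset hull_inc subsetD)
  ultimately show ?thesis
    by (simp add: sail_eq_frontier frontier_def)
qed

text \<open>
  Every level \<open>j \<le> k\<close> still has a point with \<open>h \<bullet> w \<le> r\<close>, because otherwise the closed halfspace
  \<open>h \<bullet> x \<ge> r\<close> would contain the hull at level \<open>k\<close>, hence also \<open>v\<close>. A minimiser of \<open>h\<close> at level \<open>j\<close> belongs to
  the \<open>j\<close>-th sail and is absent from all later levels, so the \<open>k\<close> minimisers are distinct. The strict
  margin \<open>h \<bullet> v < r\<close> covers points \<open>v\<close> that are merely limits of points of the hull.
\<close>
lemma sail_depth_le_card:
  assumes v: "v \<in> sail K k" and h: "h \<noteq> 0" and r: "h \<bullet> v < r"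
    and fin: "finite {w \<in> integer_points K. h \<bullet> w \<le> r}"
  shows "k \<le> card {w \<in> integer_points K. h \<bullet> w \<le> r}"
proof -
  let ?S = "{w \<in> integer_points K. h \<bullet> w \<le> r}"
  have ex_low: "\<exists>w\<in>level_points K k. h \<bullet> w \<le> r"
  proof (rule ccontr)
    assume "\<not> ?thesis"
    then have "level_points K k \<subseteq> {x. h \<bullet> x \<ge> r}" by force
    then have "convex hull (level_points K k) \<subseteq> {x. h \<bullet> x \<ge> r}"
      by (rule hull_minimal) (rule convex_halfspace_ge)
    then have "closure (convex hull (level_points K k)) \<subseteq> {x. h \<bullet> x \<ge> r}"
      by (rule closure_minimal) (rule closed_halfspace_ge)
    moreover have "v \<in> closure (convex hull (level_points K k))"
      using v by (simp add: sail_eq_frontier frontier_def)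
    ultimately show False using r by auto
  qed
  have "\<exists>w\<in>level_points K j. h \<bullet> w \<le> r \<and> w \<in> sail K j" if j: "j \<le> k" for j
  proof -
    let ?T = "{w \<in> level_points K j. h \<bullet> w \<le> r}"
    have "finite ?T"
      by (rule finite_subset[OF _ fin]) (auto simp: level_points_def)
    moreover have "?T \<noteq> {}" using ex_low level_points_antimono[OF j] by blast
    ultimately obtain w where w: "w \<in> ?T" "\<And>x. x \<in> ?T \<Longrightarrow> h \<bullet> w \<le> h \<bullet> x"
      by (metis (no_types, lifting) arg_min_if_finite(1) arg_min_least)
    have "w \<in> sail K j"
    proof (rule minimizer_in_sail[OF _ h])
      show "w \<in> level_points K j" using w by blast
      show "h \<bullet> w \<le> h \<bullet> x" if "x \<in> level_points K j" for x
        using w that by (cases "h \<bullet> x \<le> r") auto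
    qed
    then show ?thesis using w by blast
  qed
  then obtain p where p: "\<And>j. j \<le> k \<Longrightarrow>
      p j \<in> level_points K j \<and> h \<bullet> p j \<le> r \<and> p j \<in> sail K j"
    by metis
  have neq: "p i \<noteq> p j" if "1 \<le> i" "i < j" "j \<le> k" for i j
    using p[of i] p[of j] that by (auto simp: level_points_def)
  have "inj_on p {1..k}"
    by (rule inj_onI) (metis atLeastAtMost_iff linorder_neqE_nat neq)
  moreover have "p ` {1..k} \<subseteq> ?S"
    using p by (auto simp: level_points_def)
  ultimately show ?thesis
    using card_inj_on_le[OF _ _ fin] by fastforce
qed

section \<open>Real eigenlines\<close>

definition cross :: "real^2 \<Rightarrow> real^2 \<Rightarrow> real" where
  "cross u w = u $ 1 * w $ 2 - u $ 2 * w $ 1"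

lemma cross_add_left: "cross (u + v) w = cross u w + cross v w"
  and cross_add_right: "cross w (u + v) = cross w u + cross w v"
  and cross_diff_left: "cross (u - v) w = cross u w - cross v w"
  and cross_diff_right: "cross w (u - v) = cross w u - cross w v"
  and cross_scaleR_left: "cross (a *\<^sub>R u) w = a * cross u w"
  and cross_scaleR_right: "cross w (a *\<^sub>R u) = a * cross w u"
  by (simp_all add: cross_def algebra_simps)

lemma cross_self [simp]: "cross u u = 0"
  by (simp add: cross_def)

lemma cross_flip: "cross w u = - cross u w"
  by (simp add: cross_def)

lemmas cross_simps = cross_add_left cross_add_right cross_diff_left cross_diff_right
  cross_scaleR_left cross_scaleR_right

text \<open>
Cramer's rule.
\<close>
lemma cross_basis_expansion:
  assumes "cross u1 u2 \<noteq> 0"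
  shows "w = (cross w u2 / cross u1 u2) *\<^sub>R u1 + (cross u1 w / cross u1 u2) *\<^sub>R u2"
proof -
  have "cross u1 u2 * w $ i = cross w u2 * u1 $ i + cross u1 w * u2 $ i" for i
    using exhaust_2[of i] by (auto simp: cross_def algebra_simps)
  then show ?thesis using assms by (simp add: vec_eq_iff field_simps)
qed

lemma cross_basis_eq_iff:
  assumes "cross u1 u2 \<noteq> 0"
  shows "a *\<^sub>R u1 + b *\<^sub>R u2 = c *\<^sub>R u1 + d *\<^sub>R u2 \<longleftrightarrow> a = c \<and> b = d"
proof
  assume eq: "a *\<^sub>R u1 + b *\<^sub>R u2 = c *\<^sub>R u1 + d *\<^sub>R u2"
  have "cross (a *\<^sub>R u1 + b *\<^sub>R u2) u2 = cross (c *\<^sub>R u1 + d *\<^sub>R u2) u2"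
    "cross u1 (a *\<^sub>R u1 + b *\<^sub>R u2) = cross u1 (c *\<^sub>R u1 + d *\<^sub>R u2)"
    using eq by simp_all
  then show "a = c \<and> b = d" using assms by (simp add: cross_simps)
qed auto

lemma cross_eq_0_parallel:
  assumes "cross u w = 0" "u \<noteq> 0"
  obtains t where "w = t *\<^sub>R u"
proof -
  obtain i where i: "u $ i \<noteq> 0" using assms(2) by (auto simp: vec_eq_iff)
  have "w $ j = (w $ i / u $ i) * u $ j" for j
    using exhaust_2[of i] exhaust_2[of j] i assms(1) by (auto simp: cross_def field_simps)
  then have "w = (w $ i / u $ i) *\<^sub>R u"
    unfolding vec_eq_iff vector_scaleR_component real_scaleR_def by blast
  then show thesis by (rule that)
qed

lemma complexify_nth [simp]: "complexify w $ i = complex_of_real (w $ i)"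
  by (simp add: complexify_def)

lemma complexify_eq_iff [simp]: "complexify v = complexify w \<longleftrightarrow> v = w"
  by (simp add: vec_eq_iff)

lemma complexify_eq_0_iff [simp]: "complexify v = 0 \<longleftrightarrow> v = 0"
  by (simp add: vec_eq_iff)

lemma complexify_scaleR: "complexify (t *\<^sub>R v) = complex_of_real t *s complexify v"
  by (simp add: vec_eq_iff)

lemma complexify_matrix_vector_mult:
  "map_matrix complex_of_real M *v complexify w = complexify (M *v w)"
  by (simp add: vec_eq_iff matrix_vector_mult_def map_matrix_def)

lemma span_complexify: "vec.span {complexify u} = range (\<lambda>c. c *s complexify u)"
  by (rule vec.span_singleton)

lemma span_complexify_eq_iff:
  assumes "u \<noteq> 0" "v \<noteq> 0"
  shows "vec.span {complexify u} = vec.span {complexify v} \<longleftrightarrow> cross u v = 0"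
proof
  assume "vec.span {complexify u} = vec.span {complexify v}"
  then have "complexify u \<in> vec.span {complexify v}"
    by (metis insertI1 vec.span_base)
  then obtain c where c: "complexify u = c *s complexify v"
    by (auto simp: span_complexify)
  then have e: "complex_of_real (u $ i) = c * complex_of_real (v $ i)" for i
    by (simp add: vec_eq_iff)
  have "complex_of_real (cross u v) = 0"
    by (simp add: cross_def e)
  then show "cross u v = 0" by simp
next
  assume "cross u v = 0"
  then obtain t where t: "v = t *\<^sub>R u" using assms(1) by (rule cross_eq_0_parallel)
  then have "t \<noteq> 0" using assms(2) by auto
  have "complexify u = complex_of_real (1/t) *s complexify v"
    using t \<open>t \<noteq> 0\<close> by (simp add: vec_eq_iff)
  moreover have "complexify v = complex_of_real t *s complexify u"
    using t by (simp add: complexify_scaleR)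
  ultimately have "complexify u \<in> vec.span {complexify v}" "complexify v \<in> vec.span {complexify u}"
    unfolding span_complexify by (blast intro: rangeI)+
  then show "vec.span {complexify u} = vec.span {complexify v}"
    by (intro subset_antisym vec.span_minimal) (auto simp: vec.subspace_span)
qed

text \<open>
  Cramer's rule once more, now for a complex vector in a real basis.
\<close>
lemma complexify_basis_expansion:
  assumes "cross u1 u2 \<noteq> 0"
  obtains x y where "v = x *s complexify u1 + y *s complexify u2"
proof -
  let ?D = "complex_of_real (cross u1 u2)"
  define x where "x = (v $ 1 * u2 $ 2 - v $ 2 * u2 $ 1) / ?D"
  define y where "y = (u1 $ 1 * v $ 2 - u1 $ 2 * v $ 1) / ?D"
  have D: "?D \<noteq> 0" using assms by simp
  have "?D * v $ i = (v $ 1 * u2 $ 2 - v $ 2 * u2 $ 1) * u1 $ i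
      + (u1 $ 1 * v $ 2 - u1 $ 2 * v $ 1) * u2 $ i" for i
    using exhaust_2[of i] by (auto simp: cross_def algebra_simps)
  then have "v = x *s complexify u1 + y *s complexify u2"
    using D by (simp add: vec_eq_iff x_def y_def add_divide_distrib[symmetric] eq_divide_eq mult.commute)
  then show thesis by (rule that)
qed

lemma complexify_independent:
  assumes D: "cross u1 u2 \<noteq> 0" and z: "x *s complexify u1 + y *s complexify u2 = 0"
  shows "x = 0" "y = 0"
proof -
  have e: "x * u1 $ 1 + y * u2 $ 1 = 0" "x * u1 $ 2 + y * u2 $ 2 = 0"
    using z by (simp_all add: vec_eq_iff)
  have "x * complex_of_real (cross u1 u2)
      = (x * u1 $ 1 + y * u2 $ 1) * u2 $ 2 - (x * u1 $ 2 + y * u2 $ 2) * u2 $ 1"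
    by (simp add: cross_def algebra_simps)
  then show "x = 0" using e D by simp
  have "y * complex_of_real (cross u1 u2)
      = u1 $ 1 * (x * u1 $ 2 + y * u2 $ 2) - u1 $ 2 * (x * u1 $ 1 + y * u2 $ 1)"
    by (simp add: cross_def algebra_simps)
  then show "y = 0" using e D by simp
qed

lemma eigenspace_diagonal:
  assumes D: "cross u1 u2 \<noteq> 0" and M: "M *v u1 = a *\<^sub>R u1" "M *v u2 = b *\<^sub>R u2"
  shows "x *s complexify u1 + y *s complexify u2 \<in> eigenspace M c
    \<longleftrightarrow> (x = 0 \<or> c = of_real a) \<and> (y = 0 \<or> c = of_real b)"
proof -
  let ?v = "x *s complexify u1 + y *s complexify u2"
  have "map_matrix complex_of_real M *v (x *s complexify u) = (x * of_real d) *s complexify u"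
    if "M *v u = d *\<^sub>R u" for x u d
    by (simp add: vec.scale complexify_matrix_vector_mult that complexify_scaleR vector_smult_assoc)
  note scaled = this[OF M(1)] this[OF M(2)]
  have "map_matrix complex_of_real M *v ?v
      = (x * of_real a) *s complexify u1 + (y * of_real b) *s complexify u2"
    by (simp add: matrix_vector_right_distrib scaled)
  then have "?v \<in> eigenspace M c \<longleftrightarrow>
      (x * (of_real a - c)) *s complexify u1 + (y * (of_real b - c)) *s complexify u2 = 0"
    by (auto simp: eigenspace_def vec_eq_iff algebra_simps)
  then show ?thesis using complexify_independent[OF D] by fastforce
qed

lemma eigenvalues_diagonal:
  assumes D: "cross u1 u2 \<noteq> 0" and M: "M *v u1 = a *\<^sub>R u1" "M *v u2 = b *\<^sub>R u2"
  shows "eigenvalues M = {of_real a, of_real b}"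
proof
  show "eigenvalues M \<subseteq> {of_real a, of_real b}"
  proof
    fix c assume "c \<in> eigenvalues M"
    then obtain v where v: "v \<in> eigenspace M c" "v \<noteq> 0" by (auto simp: eigenvalues_def)
    obtain x y where xy: "v = x *s complexify u1 + y *s complexify u2"
      using complexify_basis_expansion[OF D] .
    then show "c \<in> {of_real a, of_real b}"
      using v eigenspace_diagonal[OF D M, of x y c] by auto
  qed
  have "complexify u1 \<in> eigenspace M (of_real a)" "complexify u2 \<in> eigenspace M (of_real b)"
    using eigenspace_diagonal[OF D M, of 1 0 "of_real a"]
      eigenspace_diagonal[OF D M, of 0 1 "of_real b"] by simp_all
  moreover have "u1 \<noteq> 0" "u2 \<noteq> 0" using D by (auto simp: cross_def)
  ultimately show "{of_real a, of_real b} \<subseteq> eigenvalues M"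
    unfolding eigenvalues_def using complexify_eq_0_iff by blast
qed

lemma regular_diagonal_iff:
  assumes "cross u1 u2 \<noteq> 0" "M *v u1 = a *\<^sub>R u1" "M *v u2 = b *\<^sub>R u2"
  shows "regular M \<longleftrightarrow> a \<noteq> b"
  by (simp add: regular_def eigenvalues_diagonal[OF assms] card_insert_if)

lemma eigenspaces_diagonal:
  assumes D: "cross u1 u2 \<noteq> 0" and M: "M *v u1 = a *\<^sub>R u1" "M *v u2 = b *\<^sub>R u2"
    and ne: "a \<noteq> b"
  shows "eigenspace M ` eigenvalues M = {vec.span {complexify u1}, vec.span {complexify u2}}"
proof -
  have "v \<in> eigenspace M (of_real a) \<longleftrightarrow> v \<in> vec.span {complexify u1}" for v
  proof -
    obtain x y where xy: "v = x *s complexify u1 + y *s complexify u2"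
      using complexify_basis_expansion[OF D] .
    have "v \<in> vec.span {complexify u1} \<longleftrightarrow> y = 0"
    proof
      assume "v \<in> vec.span {complexify u1}"
      then obtain c where "v = c *s complexify u1" by (auto simp: span_complexify)
      then have "(x - c) *s complexify u1 + y *s complexify u2 = 0"
        using xy by (simp add: vec_eq_iff algebra_simps)
      then show "y = 0" using complexify_independent[OF D] by blast
    qed (simp add: xy vec.span_scale vec.span_base)
    then show ?thesis using ne eigenspace_diagonal[OF D M] by (auto simp: xy)
  qed
  moreover have "v \<in> eigenspace M (of_real b) \<longleftrightarrow> v \<in> vec.span {complexify u2}" for v
  proof -
    obtain x y where xy: "v = x *s complexify u1 + y *s complexify u2"
      using complexify_basis_expansion[OF D] .
    have "v \<in> vec.span {complexify u2} \<longleftrightarrow> x = 0"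
    proof
      assume "v \<in> vec.span {complexify u2}"
      then obtain c where "v = c *s complexify u2" by (auto simp: span_complexify)
      then have "x *s complexify u1 + (y - c) *s complexify u2 = 0"
        using xy by (simp add: vec_eq_iff algebra_simps)
      then show "x = 0" using complexify_independent[OF D] by blast
    qed (simp add: xy vec.span_scale vec.span_base)
    then show ?thesis using ne eigenspace_diagonal[OF D M] by (auto simp: xy)
  qed
  ultimately show ?thesis
    by (auto simp: eigenvalues_diagonal[OF D M])
qed

lemma MCRS_group_regular:
  assumes "MCRS_group \<A>" obtains M where "M \<in> \<A>" "regular M"
  using assms by (auto simp: MCRS_group_def)

lemma has_eigenspaces_unique:
  assumes "MCRS_group \<A>" "has_eigenspaces \<A> l1 l2" "has_eigenspaces \<A> m1 m2"
  shows "m1 = l1 \<and> m2 = l2 \<or> m1 = l2 \<and> m2 = l1"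
proof -
  obtain M where M: "M \<in> \<A>" "regular M" using MCRS_group_regular[OF assms(1)] .
  have "eigenspace M ` eigenvalues M = {l1, l2}" "eigenspace M ` eigenvalues M = {m1, m2}"
    using assms(2,3) M unfolding has_eigenspaces_def by blast+
  then have "{l1, l2} = {m1, m2}" by (rule trans[OF sym])
  then show ?thesis by (auto simp: doubleton_eq_iff)
qed

lemma has_eigenspaces_commute: "has_eigenspaces \<A> l1 l2 \<longleftrightarrow> has_eigenspaces \<A> l2 l1"
  by (auto simp: has_eigenspaces_def insert_commute)

lemma has_eigenspaces_cross_nonzero:
  assumes "has_eigenspaces \<A> (vec.span {complexify u1}) (vec.span {complexify u2})"
    "u1 \<noteq> 0" "u2 \<noteq> 0"
  shows "cross u1 u2 \<noteq> 0"
  using assms span_complexify_eq_iff by (auto simp: has_eigenspaces_def)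

lemma eigenvector_of_real_eigenspace:
  assumes e: "eigenspace M c = vec.span {complexify u}" and u: "u \<noteq> 0"
  shows "\<exists>a. c = of_real a \<and> M *v u = a *\<^sub>R u"
proof -
  have "complexify u \<in> eigenspace M c" unfolding e by (simp add: vec.span_base)
  then have m: "complexify (M *v u) = c *s complexify u"
    by (simp add: eigenspace_def complexify_matrix_vector_mult)
  obtain i where i: "u $ i \<noteq> 0" using u by (auto simp: vec_eq_iff)
  have "complex_of_real ((M *v u) $ i) = c * complex_of_real (u $ i)"
    using m by (metis complexify_nth vector_smult_component)
  then have c: "c = of_real ((M *v u) $ i / u $ i)"
    using i by (simp add: field_simps)
  let ?a = "(M *v u) $ i / u $ i"
  have "complexify (M *v u) = complexify (?a *\<^sub>R u)"
    unfolding m complexify_scaleR c ..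
  then have "M *v u = ?a *\<^sub>R u" unfolding complexify_eq_iff .
  then show ?thesis using c by blast
qed

lemma real_eigenspaces_diagonalise:
  assumes hs: "has_eigenspaces \<A> (vec.span {complexify u1}) (vec.span {complexify u2})"
    and u: "u1 \<noteq> 0" "u2 \<noteq> 0" and M: "M \<in> \<A>" "regular M"
  obtains a b where "M *v u1 = a *\<^sub>R u1" "M *v u2 = b *\<^sub>R u2" "a \<noteq> b"
proof -
  have im: "eigenspace M ` eigenvalues M = {vec.span {complexify u1}, vec.span {complexify u2}}"
    using hs M by (simp add: has_eigenspaces_def)
  obtain c1 where "eigenspace M c1 = vec.span {complexify u1}"
    using im by (metis imageE insertI1)
  then obtain a where a: "M *v u1 = a *\<^sub>R u1" using eigenvector_of_real_eigenspace u by blast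
  obtain c2 where "eigenspace M c2 = vec.span {complexify u2}"
    using im by (metis imageE insertI1 insertI2)
  then obtain b where b: "M *v u2 = b *\<^sub>R u2" using eigenvector_of_real_eigenspace u by blast
  have "a \<noteq> b"
    using regular_diagonal_iff[OF has_eigenspaces_cross_nonzero[OF hs u] a b] M by blast
  then show thesis using a b that by blast
qed

text \<open>
  The real and imaginary parts of a complex eigenvector satisfy the same equation, and one of them is
  nonzero.
\<close>
lemma real_eigenvalue_real_eigenvector:
  assumes "complex_of_real a \<in> eigenvalues M"
  obtains u where "u \<noteq> 0" "M *v u = a *\<^sub>R u"
proof -
  obtain v where v: "map_matrix complex_of_real M *v v = of_real a *s v" "v \<noteq> 0"
    using assms by (auto simp: eigenvalues_def eigenspace_def)
  define p where "p = (\<chi> i. Re (v $ i))"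
  define q where "q = (\<chi> i. Im (v $ i))"
  have comp: "(\<Sum>j\<in>UNIV. complex_of_real (M $ i $ j) * v $ j) = of_real a * v $ i" for i
    using v(1) by (simp add: vec_eq_iff matrix_vector_mult_def map_matrix_def)
  have "(\<Sum>j\<in>UNIV. M $ i $ j * Re (v $ j)) = a * Re (v $ i)"
    "(\<Sum>j\<in>UNIV. M $ i $ j * Im (v $ j)) = a * Im (v $ i)" for i
    using arg_cong[OF comp[of i], of Re] arg_cong[OF comp[of i], of Im] by simp_all
  then have "M *v p = a *\<^sub>R p" "M *v q = a *\<^sub>R q"
    by (simp_all add: vec_eq_iff matrix_vector_mult_def p_def q_def)
  moreover have "p \<noteq> 0 \<or> q \<noteq> 0"
    using v(2) by (auto simp: vec_eq_iff p_def q_def complex_eq_iff)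
  ultimately show thesis using that by blast
qed

lemma diagonal_eigenvector_parallel:
  assumes D: "cross u1 u2 \<noteq> 0" and M: "M *v u1 = a *\<^sub>R u1" "M *v u2 = b *\<^sub>R u2"
    and ne: "a \<noteq> b"
  shows "M *v v = a *\<^sub>R v \<Longrightarrow> (\<And>t. v = t *\<^sub>R u1 \<Longrightarrow> thesis) \<Longrightarrow> thesis"
    and "M *v v = b *\<^sub>R v \<Longrightarrow> (\<And>t. v = t *\<^sub>R u2 \<Longrightarrow> thesis) \<Longrightarrow> thesis"
proof -
  define x where "x = cross v u2 / cross u1 u2"
  define y where "y = cross u1 v / cross u1 u2"
  have v: "v = x *\<^sub>R u1 + y *\<^sub>R u2"
    unfolding x_def y_def by (rule cross_basis_expansion[OF D])
  have Mv: "M *v v = (x * a) *\<^sub>R u1 + (y * b) *\<^sub>R u2"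
    by (simp add: v matrix_vector_right_distrib matrix_vector_mult_scaleR M)
  have dv: "d *\<^sub>R v = (x * d) *\<^sub>R u1 + (y * d) *\<^sub>R u2" for d
    by (simp add: v algebra_simps)
  have eig: "M *v v = d *\<^sub>R v \<longleftrightarrow> x * a = x * d \<and> y * b = y * d" for d
    unfolding Mv dv by (rule cross_basis_eq_iff[OF D])
  show thesis if "M *v v = a *\<^sub>R v" "\<And>t. v = t *\<^sub>R u1 \<Longrightarrow> thesis"
    using that(1) eig[of a] v ne by (intro that(2)[of x]) auto
  show thesis if "M *v v = b *\<^sub>R v" "\<And>t. v = t *\<^sub>R u2 \<Longrightarrow> thesis"
    using that(1) eig[of b] v ne by (intro that(2)[of y]) auto
qed

text \<open>
  One regular element with real eigenvalues provides real eigenvectors. All other elements commute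
  with it, hence preserve its eigenlines.
\<close>
lemma hyperbolic_real_eigenspaces:
  assumes A: "MCRS_group \<A>" "hyperbolic \<A>"
  obtains u1 u2 where "u1 \<noteq> 0" "u2 \<noteq> 0"
    "has_eigenspaces \<A> (vec.span {complexify u1}) (vec.span {complexify u2})"
proof -
  obtain M where M: "M \<in> \<A>" "regular M" "eigenvalues M \<subseteq> \<real>"
    using A(2) by (auto simp: hyperbolic_def)
  then obtain c1 c2 where c: "eigenvalues M = {c1, c2}" "c1 \<noteq> c2"
    by (auto simp: regular_def card_2_iff)
  then obtain a b where ab: "c1 = of_real a" "c2 = of_real b" using M(3) by (auto elim!: Reals_cases)
  obtain u1 where u1: "u1 \<noteq> 0" "M *v u1 = a *\<^sub>R u1"
    using real_eigenvalue_real_eigenvector[of a M] c ab by auto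
  obtain u2 where u2: "u2 \<noteq> 0" "M *v u2 = b *\<^sub>R u2"
    using real_eigenvalue_real_eigenvector[of b M] c ab by auto
  have ne: "a \<noteq> b" using c ab by auto
  have D: "cross u1 u2 \<noteq> 0"
  proof
    assume "cross u1 u2 = 0"
    then obtain t where t: "u2 = t *\<^sub>R u1" using u1 cross_eq_0_parallel by metis
    then have "M *v u2 = a *\<^sub>R u2" using u1(2) by (simp add: matrix_vector_mult_scaleR)
    then show False using u2 ne by simp
  qed
  have "eigenspace M' ` eigenvalues M' = {vec.span {complexify u1}, vec.span {complexify u2}}"
    if M': "M' \<in> \<A>" "regular M'" for M'
  proof -
    have comm: "M ** M' = M' ** M"
      using A(1) M(1) M'(1) by (auto simp: MCRS_group_def commutative_subgroup_def)
    have M'eig: "M *v (M' *v u) = d *\<^sub>R (M' *v u)" if "M *v u = d *\<^sub>R u" for u d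
    proof -
      have "M *v (M' *v u) = M' *v (M *v u)"
        by (simp only: matrix_vector_mul_assoc comm)
      then show ?thesis by (simp add: that matrix_vector_mult_scaleR)
    qed
    obtain a' where a': "M' *v u1 = a' *\<^sub>R u1" using diagonal_eigenvector_parallel(1)[OF D u1(2) u2(2) ne M'eig[OF u1(2)]] .
    obtain b' where b': "M' *v u2 = b' *\<^sub>R u2" using diagonal_eigenvector_parallel(2)[OF D u1(2) u2(2) ne M'eig[OF u2(2)]] .
    show ?thesis
      using eigenspaces_diagonal[OF D a' b'] regular_diagonal_iff[OF D a' b'] M'(2) by blast
  qed
  then have "has_eigenspaces \<A> (vec.span {complexify u1}) (vec.span {complexify u2})"
    using span_complexify_eq_iff[OF u1(1) u2(1)] D by (auto simp: has_eigenspaces_def)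
  then show thesis using that u1 u2 by blast
qed

section \<open>Primitive Gaussian vectors and size\<close>

lemma max_abs_le_iff: "max_abs v \<le> e \<longleftrightarrow> (\<forall>i. norm (v $ i) \<le> e)"
  by (auto simp: max_abs_def)

lemma norm_nth_le_max_abs: "norm (v $ i) \<le> max_abs v"
  using max_abs_le_iff[of v "max_abs v"] by simp

lemma max_abs_nonneg: "0 \<le> max_abs v"
  using norm_nth_le_max_abs[of v] norm_ge_zero order_trans by blast

lemma max_abs_scale: "max_abs (c *s v) = norm c * max_abs v"
proof (rule antisym)
  show "max_abs (c *s v) \<le> norm c * max_abs v"
    by (simp add: max_abs_le_iff norm_mult mult_left_mono norm_nth_le_max_abs)
  show "norm c * max_abs v \<le> max_abs (c *s v)"
  proof (cases "c = 0")
    case False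
    have "norm (v $ i) \<le> max_abs (c *s v) / norm c" for i
      using norm_nth_le_max_abs[of "c *s v" i] False by (simp add: norm_mult field_simps)
    then have "max_abs v \<le> max_abs (c *s v) / norm c"
      by (simp add: max_abs_le_iff)
    then show ?thesis using False by (simp add: field_simps)
  qed (simp add: max_abs_nonneg)
qed

lemma max_abs_minus: "max_abs (- v) = max_abs v"
  by (simp add: max_abs_def)

lemma gaussian_integers_closed [simp, intro]:
  "x \<in> gaussian_integers \<Longrightarrow> y \<in> gaussian_integers \<Longrightarrow> x + y \<in> gaussian_integers"
  "x \<in> gaussian_integers \<Longrightarrow> y \<in> gaussian_integers \<Longrightarrow> x - y \<in> gaussian_integers"
  "x \<in> gaussian_integers \<Longrightarrow> y \<in> gaussian_integers \<Longrightarrow> x * y \<in> gaussian_integers"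
  "0 \<in> gaussian_integers" "1 \<in> gaussian_integers"
  by (auto simp: gaussian_integers_def)

lemma gaussian_integer_norm_ge_1:
  assumes "z \<in> gaussian_integers" "z \<noteq> 0"
  shows "1 \<le> norm z"
proof -
  obtain a b where ab: "Re z = of_int a" "Im z = of_int b"
    using assms(1) by (auto simp: gaussian_integers_def elim!: Ints_cases)
  have "a \<noteq> 0 \<or> b \<noteq> 0" using assms(2) ab by (auto simp: complex_eq_iff)
  then have "1 \<le> \<bar>Re z\<bar> \<or> 1 \<le> \<bar>Im z\<bar>" using ab by (auto simp flip: of_int_abs)
  then show ?thesis using abs_Re_le_cmod[of z] abs_Im_le_cmod[of z] by linarith
qed

lemma gaussian_norm_square_nat:
  assumes "z \<in> gaussian_integers" shows "\<exists>n. (norm z)\<^sup>2 = real n"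
proof -
  obtain a b where ab: "Re z = of_int a" "Im z = of_int b"
    using assms by (auto simp: gaussian_integers_def elim!: Ints_cases)
  have "(norm z)\<^sup>2 = of_int (a\<^sup>2 + b\<^sup>2)" by (simp add: cmod_power2 ab)
  also have "\<dots> = real (nat (a\<^sup>2 + b\<^sup>2))" by simp
  finally show ?thesis by blast
qed

text \<open>
  Rounding both coordinates of the quotient leaves an error of norm at most \<open>sqrt (1/2)\<close>.
\<close>
lemma gaussian_division:
  assumes "d \<noteq> 0"
  obtains q where "q \<in> gaussian_integers" "norm (z - q * d) < norm d"
proof -
  define q where "q = Complex (of_int (round (Re (z/d)))) (of_int (round (Im (z/d))))"
  have "\<bar>Re (z/d - q)\<bar> \<le> 1/2" "\<bar>Im (z/d - q)\<bar> \<le> 1/2"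
    using of_int_round_abs_le[of "Re (z/d)"] of_int_round_abs_le[of "Im (z/d)"]
    by (simp_all add: q_def abs_minus_commute)
  then have "(Re (z/d - q))\<^sup>2 \<le> (1/2)\<^sup>2" "(Im (z/d - q))\<^sup>2 \<le> (1/2)\<^sup>2"
    by (simp_all add: abs_le_square_iff[symmetric])
  then have "(norm (z/d - q))\<^sup>2 < 1\<^sup>2"
    unfolding cmod_power2 by (simp add: power2_eq_square)
  then have "norm (z/d - q) < 1" using power_less_imp_less_base by fastforce
  moreover have "z - q * d = (z/d - q) * d" using assms by (simp add: field_simps)
  ultimately have "norm (z - q * d) < norm d" using assms by (simp add: norm_mult)
  moreover have "q \<in> gaussian_integers" by (simp add: q_def gaussian_integers_def)
  ultimately show thesis using that by blast
qed

lemma primitive_nonzero: "primitive v \<Longrightarrow> v \<noteq> 0"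
  unfolding primitive_def
  by (metis gaussian_integers_closed(4) mult_zero_left zero_index zero_neq_one)

text \<open>
  The nonzero element of least norm among the Gaussian combinations of the coordinates divides both
  coordinates by Euclidean division, so it is a unit.
\<close>
lemma primitive_bezout:
  assumes "primitive v"
  obtains a b where "a \<in> gaussian_integers" "b \<in> gaussian_integers" "a * v $ 1 + b * v $ 2 = 1"
proof -
  let ?G = gaussian_integers
  define S where "S = {a * v $ 1 + b * v $ 2 |a b. a \<in> ?G \<and> b \<in> ?G}"
  have vG: "v $ i \<in> ?G" for i using assms by (simp add: primitive_def gaussian_vector_def)
  have SG: "S \<subseteq> ?G" using vG by (auto simp: S_def)
  have vS: "v $ i \<in> S" for i
  proof -
    have "v $ 1 \<in> S" unfolding S_def by (rule CollectI, rule exI[of _ 1], rule exI[of _ 0]) simp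
    moreover have "v $ 2 \<in> S" unfolding S_def by (rule CollectI, rule exI[of _ 0], rule exI[of _ 1]) simp
    ultimately show ?thesis using exhaust_2[of i] by auto
  qed
  have S_sub: "x - q * y \<in> S" if xy: "x \<in> S" "y \<in> S" and q: "q \<in> ?G" for x y q
  proof -
    obtain a b where x: "x = a * v $ 1 + b * v $ 2" "a \<in> ?G" "b \<in> ?G"
      using xy(1) by (auto simp: S_def)
    obtain c d where y: "y = c * v $ 1 + d * v $ 2" "c \<in> ?G" "d \<in> ?G"
      using xy(2) by (auto simp: S_def)
    have "x - q * y = (a - q * c) * v $ 1 + (b - q * d) * v $ 2"
      by (simp add: x y algebra_simps)
    then show ?thesis using x y q unfolding S_def by blast
  qed
  obtain i where i: "v $ i \<noteq> 0" using primitive_nonzero[OF assms] by (auto simp: vec_eq_iff)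
  obtain d where d: "d \<in> S" "d \<noteq> 0"
    and least: "\<And>y. y \<in> S \<Longrightarrow> y \<noteq> 0 \<Longrightarrow> nat \<lfloor>(norm d)\<^sup>2\<rfloor> \<le> nat \<lfloor>(norm y)\<^sup>2\<rfloor>"
    using ex_has_least_nat[of "\<lambda>x. x \<in> S \<and> x \<noteq> 0" "v $ i" "\<lambda>x. nat \<lfloor>(norm x)\<^sup>2\<rfloor>"] vS i by blast
  have least': "norm d \<le> norm y" if y: "y \<in> S" "y \<noteq> 0" for y
  proof -
    obtain m where "(norm d)\<^sup>2 = real m"
      using gaussian_norm_square_nat[OF subsetD[OF SG d(1)]] by blast
    moreover obtain n where "(norm y)\<^sup>2 = real n"
      using gaussian_norm_square_nat[OF subsetD[OF SG y(1)]] by blast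
    ultimately have "(norm d)\<^sup>2 \<le> (norm y)\<^sup>2" using least[OF y] by simp
    then show ?thesis by (simp add: power2_le_iff_abs_le)
  qed
  have "\<exists>q\<in>?G. v $ j = d * q" for j
  proof -
    obtain q where q: "q \<in> ?G" "norm (v $ j - q * d) < norm d"
      using gaussian_division[OF d(2)] .
    have "v $ j - q * d = 0"
      using least'[OF S_sub[OF vS d(1) q(1)]] q(2) by fastforce
    then show ?thesis using q(1) by (intro bexI[of _ q]) (simp_all add: mult.commute)
  qed
  then obtain u where u: "u \<in> ?G" "d * u = 1"
    using assms subsetD[OF SG d(1)] unfolding primitive_def by blast
  obtain a b where ab: "d = a * v $ 1 + b * v $ 2" "a \<in> ?G" "b \<in> ?G"
    using d(1) by (auto simp: S_def)
  show thesis
  proof (rule that)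
    show "a * u \<in> ?G" "b * u \<in> ?G" using ab u by auto
    show "a * u * v $ 1 + b * u * v $ 2 = 1" using u(2) by (simp add: ab algebra_simps)
  qed
qed

lemma primitive_multiplier_gaussian:
  assumes "primitive v" "gaussian_vector (t *s v)"
  shows "t \<in> gaussian_integers"
proof -
  obtain a b where ab: "a \<in> gaussian_integers" "b \<in> gaussian_integers" "a * v $ 1 + b * v $ 2 = 1"
    using primitive_bezout[OF assms(1)] .
  have "t = a * (t *s v) $ 1 + b * (t *s v) $ 2"
    using arg_cong[OF ab(3), of "\<lambda>x. t * x"] by (simp add: algebra_simps)
  moreover have "(t *s v) $ i \<in> gaussian_integers" for i
    using assms(2) by (simp add: gaussian_vector_def)
  ultimately show ?thesis using ab by (metis gaussian_integers_closed(1,3))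
qed

text \<open>
  By Bezout, the factor between two primitive vectors and its inverse are both Gaussian integers,
  so it is a unit and has modulus 1. This makes the size of a rational group well defined.
\<close>
lemma primitive_max_abs_unique:
  assumes v: "primitive v" and w: "primitive w" "w = t *s v"
  shows "max_abs w = max_abs v"
proof -
  have t0: "t \<noteq> 0" using primitive_nonzero[OF w(1)] w(2) by (metis vector_smult_lzero)
  have "v = (1/t) *s w" unfolding w(2) using t0 by (simp add: vector_smult_assoc)
  then have "1/t \<in> gaussian_integers"
    using primitive_multiplier_gaussian[OF w(1)] v by (metis primitive_def)
  then have "1 \<le> norm (1/t)" using t0 by (intro gaussian_integer_norm_ge_1) auto
  then have "norm t \<le> 1" using t0 by (simp add: norm_divide field_simps)
  moreover have "t \<in> gaussian_integers"
    using primitive_multiplier_gaussian[OF v] w by (auto simp: primitive_def)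
  then have "1 \<le> norm t" using t0 by (rule gaussian_integer_norm_ge_1)
  ultimately show ?thesis using w(2) by (simp add: max_abs_scale)
qed

lemma group_size_eq:
  assumes A: "MCRS_group \<A>"
    and hs: "has_eigenspaces \<A> (vec.span {w1}) (vec.span {w2})"
    and w: "primitive w1" "primitive w2"
  shows "group_size \<A> = max (max_abs w1) (max_abs w2)"
  unfolding group_size_def
proof (rule the_equality)
  show "\<exists>l1 l2 v1 v2. has_eigenspaces \<A> l1 l2 \<and> v1 \<in> l1 \<and> primitive v1 \<and> v2 \<in> l2 \<and>
      primitive v2 \<and> max (max_abs w1) (max_abs w2) = max (max_abs v1) (max_abs v2)"
    using hs w by (intro exI[of _ "vec.span {w1}"] exI[of _ "vec.span {w2}"] exI[of _ w1] exI[of _ w2])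
      (simp add: vec.span_base)
  fix r
  assume "\<exists>l1 l2 v1 v2. has_eigenspaces \<A> l1 l2 \<and> v1 \<in> l1 \<and> primitive v1 \<and> v2 \<in> l2 \<and>
      primitive v2 \<and> r = max (max_abs v1) (max_abs v2)"
  then obtain l1 l2 v1 v2 where l: "has_eigenspaces \<A> l1 l2"
    and v: "v1 \<in> l1" "primitive v1" "v2 \<in> l2" "primitive v2"
    and r: "r = max (max_abs v1) (max_abs v2)" by blast
  have eq: "max_abs v = max_abs w" if "v \<in> vec.span {w}" "primitive v" "primitive w" for v w
    using that primitive_max_abs_unique by (auto simp: vec.span_singleton)
  from has_eigenspaces_unique[OF A hs l] show "r = max (max_abs w1) (max_abs w2)"
    using v w eq[of v1 w1] eq[of v2 w2] eq[of v1 w2] eq[of v2 w1] r by (auto simp: max.commute)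
qed

lemma max_abs_complexify_le_iff:
  "max_abs (complexify w) \<le> e \<longleftrightarrow> (\<forall>i. \<bar>w $ i\<bar> \<le> e)"
  by (simp add: max_abs_le_iff)

lemma primitive_complexify_coprime:
  assumes "w $ 1 = real_of_int h" "w $ 2 = real_of_int k" "coprime h k"
  shows "primitive (complexify w)"
  unfolding primitive_def
proof (intro conjI ballI impI)
  show "gaussian_vector (complexify w)"
    using assms by (simp add: gaussian_vector_def gaussian_integers_def forall_2)
  fix d assume d: "d \<in> gaussian_integers"
    and dvd: "\<forall>i. \<exists>a\<in>gaussian_integers. complexify w $ i = d * a"
  obtain a where a: "a \<in> gaussian_integers" "of_int h = d * a"
    using dvd[rule_format, of 1] assms by auto
  obtain b where b: "b \<in> gaussian_integers" "of_int k = d * b"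
    using dvd[rule_format, of 2] assms by auto
  obtain x y where xy: "x * h + y * k = 1"
    using assms(3) by (metis bezout_int coprime_imp_gcd_eq_1)
  have "of_int x * of_int h + of_int y * of_int k = (1::complex)"
    using arg_cong[OF xy, of "of_int :: int \<Rightarrow> complex"] by simp
  then have "d * (of_int x * a + of_int y * b) = 1"
    by (simp add: a b algebra_simps)
  moreover have "of_int x * a + of_int y * b \<in> gaussian_integers"
    using a b by (auto simp: gaussian_integers_def)
  ultimately show "\<exists>u\<in>gaussian_integers. d * u = 1" by blast
qed

lemma primitive_complexify_integral:
  assumes "primitive (complexify w)" shows "w $ i \<in> \<int>"
  using assms by (auto simp: primitive_def gaussian_vector_def gaussian_integers_def)

lemma integer_vector_primitive_multiple:
  fixes w :: "real^2"
  assumes "\<And>i. w $ i \<in> \<int>" "w \<noteq> 0"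
  obtains t p where "w = t *\<^sub>R p" "t \<noteq> 0" "primitive (complexify p)"
proof -
  obtain h where h: "w $ 1 = of_int h" using assms(1) Ints_cases by metis
  obtain k where k: "w $ 2 = of_int k" using assms(1) Ints_cases by metis
  have nz: "h \<noteq> 0 \<or> k \<noteq> 0" using assms(2) h k by (auto simp: vec_eq_iff forall_2)
  obtain h' k' where hk: "h = h' * gcd h k" "k = k' * gcd h k" "coprime h' k'"
    using gcd_coprime_exists[of h k] nz by auto
  define p :: "real^2" where "p = vector [of_int h', of_int k']"
  have "w = of_int (gcd h k) *\<^sub>R p"
    using hk(1,2) h k by (simp add: vec_eq_iff forall_2 p_def flip: of_int_mult) (metis mult.commute)
  moreover have "primitive (complexify p)"
    by (rule primitive_complexify_coprime[OF _ _ hk(3)]) (simp_all add: p_def)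
  ultimately show thesis using that nz by (metis gcd_eq_0_iff of_int_eq_0_iff)
qed

section \<open>The group with prescribed real eigenlines\<close>

text \<open>
  The candidates for approximating groups: for linearly independent \<open>u1\<close> and \<open>u2\<close> this is the
  MCRS-group with these eigenlines.
\<close>
definition adapted_group :: "real^2 \<Rightarrow> real^2 \<Rightarrow> (real^2^2) set" where
  "adapted_group u1 u2 =
     {M. invertible M \<and> (\<exists>a. M *v u1 = a *\<^sub>R u1) \<and> (\<exists>b. M *v u2 = b *\<^sub>R u2)}"

lemma matrix_eqI_on_basis:
  fixes M M' :: "real^2^2"
  assumes D: "cross u1 u2 \<noteq> 0" and "M *v u1 = M' *v u1" "M *v u2 = M' *v u2"
  shows "M = M'"
proof -
  have "M *v w = M' *v w" for w
    by (subst (1 2) cross_basis_expansion[OF D, of w])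
       (simp add: matrix_vector_right_distrib matrix_vector_mult_scaleR assms)
  then show ?thesis by (simp add: matrix_eq)
qed

lemma diagonal_matrix_exists:
  assumes D: "cross u1 u2 \<noteq> 0" and ab: "a \<noteq> 0" "b \<noteq> 0"
  obtains M :: "real^2^2" where "invertible M" "M *v u1 = a *\<^sub>R u1" "M *v u2 = b *\<^sub>R u2"
proof -
  define f where "f w = (a * (cross w u2 / cross u1 u2)) *\<^sub>R u1 + (b * (cross u1 w / cross u1 u2)) *\<^sub>R u2"
    for w
  have lin: "linear f"
    by (rule linearI) (simp_all add: f_def cross_simps add_divide_distrib algebra_simps)
  have M: "matrix f *v w = f w" for w
    using matrix_vector_mul(2)[OF lin] by metis
  have "w = 0" if "matrix f *v w = 0" for w
  proof -
    have "f w = 0 *\<^sub>R u1 + 0 *\<^sub>R u2" using that M by simp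
    then have "a * (cross w u2 / cross u1 u2) = 0" "b * (cross u1 w / cross u1 u2) = 0"
      unfolding f_def cross_basis_eq_iff[OF D] by simp_all
    then have "cross w u2 = 0" "cross u1 w = 0" using D ab by simp_all
    then show "w = 0" using cross_basis_expansion[OF D, of w] by simp
  qed
  then have "invertible (matrix f)"
    by (simp add: invertible_left_inverse matrix_left_invertible_ker)
  moreover have "f u1 = a *\<^sub>R u1" "f u2 = b *\<^sub>R u2" using D by (simp_all add: f_def)
  ultimately show thesis using that[of "matrix f"] M by simp
qed

lemma adapted_group_commutative_subgroup:
  assumes D: "cross u1 u2 \<noteq> 0"
  shows "commutative_subgroup (adapted_group u1 u2)"
proof -
  interpret GL2R: group GL2R by (rule group_GL2R)
  have "subgroup (adapted_group u1 u2) GL2R"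
  proof (rule GL2R.subgroupI)
    show "adapted_group u1 u2 \<subseteq> carrier GL2R"
      by (auto simp: adapted_group_def GL2R_def)
    have "mat 1 \<in> adapted_group u1 u2"
      using GL2R.one_closed by (auto simp: adapted_group_def GL2R_def intro: exI[of _ 1])
    then show "adapted_group u1 u2 \<noteq> {}" by blast
    fix M assume M: "M \<in> adapted_group u1 u2"
    then have Mc: "M \<in> carrier GL2R" by (simp add: adapted_group_def GL2R_def)
    let ?N = "inv\<^bsub>GL2R\<^esub> M"
    have N: "?N \<in> carrier GL2R" "?N ** M = mat 1"
      using GL2R.inv_closed[OF Mc] GL2R.l_inv[OF Mc] by (simp_all add: GL2R_def)
    have "\<exists>c. ?N *v u = c *\<^sub>R u" if "M *v u = d *\<^sub>R u" for d u
    proof -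
      have e: "u = d *\<^sub>R (?N *v u)"
        using that N(2) by (metis matrix_vector_mul_assoc matrix_vector_mul_lid matrix_vector_mult_scaleR)
      show ?thesis
      proof (cases "d = 0")
        case True
        then have "u = 0" using e by simp
        then show ?thesis by simp
      next
        case False
        then have "?N *v u = (1/d) *\<^sub>R u" by (subst (2) e) simp
        then show ?thesis by blast
      qed
    qed
    then show "?N \<in> adapted_group u1 u2"
      using M N(1) by (auto simp: adapted_group_def GL2R_def)
    fix M' assume M': "M' \<in> adapted_group u1 u2"
    have "\<exists>c. (M ** M') *v u = c *\<^sub>R u" if "M *v u = d *\<^sub>R u" "M' *v u = e *\<^sub>R u" for u d e
      using that by (intro exI[of _ "e * d"])
        (simp add: matrix_vector_mul_assoc[symmetric] matrix_vector_mult_scaleR)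
    then show "M \<otimes>\<^bsub>GL2R\<^esub> M' \<in> adapted_group u1 u2"
      using M M' by (auto simp: adapted_group_def GL2R_def invertible_mult)
  qed
  moreover have "M ** M' = M' ** M" if M: "M \<in> adapted_group u1 u2" "M' \<in> adapted_group u1 u2" for M M'
  proof -
    have "(M ** M') *v u = (M' ** M) *v u" if "M *v u = d *\<^sub>R u" "M' *v u = e *\<^sub>R u" for u d e
      using that by (simp add: matrix_vector_mul_assoc[symmetric] matrix_vector_mult_scaleR)
    then show ?thesis
      using M by (intro matrix_eqI_on_basis[OF D]) (auto simp: adapted_group_def)
  qed
  ultimately show ?thesis by (simp add: commutative_subgroup_def)
qed

text \<open>
  Maximality: whatever commutes with the diagonal matrix with distinct eigenvalues 1 and 2 preserves
  its eigenlines.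
\<close>
lemma adapted_group_MCRS:
  assumes D: "cross u1 u2 \<noteq> 0"
  shows "MCRS_group (adapted_group u1 u2)"
proof -
  obtain M :: "real^2^2" where M: "invertible M" "M *v u1 = 1 *\<^sub>R u1" "M *v u2 = 2 *\<^sub>R u2"
    using diagonal_matrix_exists[OF D, of 1 2] by auto
  have MG: "M \<in> adapted_group u1 u2" using M by (auto simp: adapted_group_def intro: exI[of _ 1])
  have "regular M" by (simp add: regular_diagonal_iff[OF D M(2,3)])
  moreover have "\<B> = adapted_group u1 u2"
    if B: "commutative_subgroup \<B>" "adapted_group u1 u2 \<subseteq> \<B>" for \<B>
  proof -
    have "X \<in> adapted_group u1 u2" if X: "X \<in> \<B>" for X
    proof -
      have comm: "M ** X = X ** M" using B MG X by (auto simp: commutative_subgroup_def)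
      have eig: "M *v (X *v u) = d *\<^sub>R (X *v u)" if "M *v u = d *\<^sub>R u" for u d
      proof -
        have "M *v (X *v u) = X *v (M *v u)"
          by (simp only: matrix_vector_mul_assoc comm)
        then show ?thesis by (simp add: that matrix_vector_mult_scaleR)
      qed
      obtain a where "X *v u1 = a *\<^sub>R u1"
        using diagonal_eigenvector_parallel(1)[OF D M(2,3) _ eig[OF M(2)]] by auto
      moreover obtain b where "X *v u2 = b *\<^sub>R u2"
        using diagonal_eigenvector_parallel(2)[OF D M(2,3) _ eig[OF M(3)]] by auto
      moreover have "invertible X"
        using B(1) X by (auto simp: commutative_subgroup_def GL2R_def dest!: subgroup.subset)
      ultimately show ?thesis by (auto simp: adapted_group_def)
    qed
    then show ?thesis using B(2) by blast
  qed
  ultimately show ?thesis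
    using adapted_group_commutative_subgroup[OF D] MG unfolding MCRS_group_def by blast
qed

lemma adapted_group_eigenspaces:
  assumes D: "cross u1 u2 \<noteq> 0"
  shows "has_eigenspaces (adapted_group u1 u2) (vec.span {complexify u1}) (vec.span {complexify u2})"
  unfolding has_eigenspaces_def
proof (intro conjI ballI impI)
  have "u1 \<noteq> 0" "u2 \<noteq> 0" using D by (auto simp: cross_def)
  then show "vec.span {complexify u1} \<noteq> vec.span {complexify u2}"
    using D span_complexify_eq_iff by blast
  fix M assume M: "M \<in> adapted_group u1 u2" "regular M"
  then obtain a b where ab: "M *v u1 = a *\<^sub>R u1" "M *v u2 = b *\<^sub>R u2"
    by (auto simp: adapted_group_def)
  then show "eigenspace M ` eigenvalues M = {vec.span {complexify u1}, vec.span {complexify u2}}"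
    using eigenspaces_diagonal[OF D ab] regular_diagonal_iff[OF D ab] M(2) by blast
qed

lemma MCRS_group_Rat2:
  assumes "MCRS_group \<A>"
    "has_eigenspaces \<A> (vec.span {complexify w1}) (vec.span {complexify w2})"
    "primitive (complexify w1)" "primitive (complexify w2)"
  shows "\<A> \<in> Rat2"
proof -
  have "\<exists>v\<in>vec.span {complexify w}. v \<noteq> 0 \<and> gaussian_vector v"
    if "primitive (complexify w)" for w
    using that primitive_nonzero[OF that]
    by (intro bexI[of _ "complexify w"]) (auto simp: primitive_def intro: vec.span_base)
  then show ?thesis using assms unfolding Rat2_def by blast
qed


section \<open>Markoff-Davenport forms and discrepancy\<close>

text \<open>
  Up to a factor, the only linear form that vanishes at a nonzero vector \<open>u\<close>.
\<close>
definition annihilator_form :: "real^2 \<Rightarrow> complex^2" where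
  "annihilator_form u = vector [complex_of_real (u $ 2), - complex_of_real (u $ 1)]"

text \<open>
  The Markoff-Davenport form of the group with eigenvectors \<open>u1\<close> and \<open>u2\<close>. Rescaling the vectors
  leaves it unchanged, exchanging them reverses its sign.
\<close>
definition MD_form :: "real^2 \<Rightarrow> real^2 \<Rightarrow> complex^3" where
  "MD_form u1 u2 = inverse (complex_of_real (cross u1 u2)) *s
     form_product (annihilator_form u1) (annihilator_form u2)"

lemma linear_form_annihilator:
  "linear_form (annihilator_form u) (complexify w) = - complex_of_real (cross u w)"
  by (simp add: linear_form_def annihilator_form_def cross_def)

lemma linear_form_vanishing_multiple:
  assumes "u \<noteq> 0" "linear_form L (complexify u) = 0"
  obtains s where "L = s *s annihilator_form u"
proof -
  have e: "L $ 1 * u $ 1 = - L $ 2 * u $ 2"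
    using assms(2) by (simp add: linear_form_def add_eq_0_iff)
  show thesis
  proof (cases "u $ 1 = 0")
    case True
    then have "u $ 2 \<noteq> 0" using assms(1) by (auto simp: vec_eq_iff forall_2)
    then show thesis using e True
      by (intro that[of "L $ 1 / u $ 2"]) (simp add: vec_eq_iff forall_2 annihilator_form_def)
  next
    case False
    then show thesis using e
      by (intro that[of "- L $ 2 / u $ 1"])
        (simp add: vec_eq_iff forall_2 annihilator_form_def field_simps)
  qed
qed

lemma quadratic_form_add: "quadratic_form (\<Phi> + \<Psi>) v = quadratic_form \<Phi> v + quadratic_form \<Psi> v"
  and quadratic_form_diff: "quadratic_form (\<Phi> - \<Psi>) v = quadratic_form \<Phi> v - quadratic_form \<Psi> v"
  and quadratic_form_scale: "quadratic_form (c *s \<Phi>) v = c * quadratic_form \<Phi> v"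
  by (simp_all add: quadratic_form_def algebra_simps)

lemma quadratic_MD_form:
  "quadratic_form (MD_form u1 u2) (complexify w)
    = complex_of_real (cross u1 w * cross u2 w / cross u1 u2)"
  by (simp add: MD_form_def quadratic_form_scale quadratic_form_product linear_form_annihilator
      divide_inverse mult.commute)

lemma norm_quadratic_form_le:
  "norm (quadratic_form \<Phi> v) \<le> 3 * max_abs \<Phi> * (max_abs v)\<^sup>2"
proof -
  have m: "norm (\<Phi> $ k * (v $ i * v $ j)) \<le> max_abs \<Phi> * (max_abs v)\<^sup>2" for k i j
    by (simp add: norm_mult power2_eq_square mult_mono norm_nth_le_max_abs max_abs_nonneg)
  have "norm (quadratic_form \<Phi> v) \<le> norm (\<Phi> $ 1 * (v $ 1 * v $ 1))
      + norm (\<Phi> $ 2 * (v $ 1 * v $ 2)) + norm (\<Phi> $ 3 * (v $ 2 * v $ 2))"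
    unfolding quadratic_form_def power2_eq_square
    by (intro order_trans[OF norm_triangle_ineq] add_mono order_refl norm_triangle_ineq)
  also have "\<dots> \<le> 3 * max_abs \<Phi> * (max_abs v)\<^sup>2"
    using m[of 1 1 1] m[of 2 1 2] m[of 3 2 2] by simp
  finally show ?thesis .
qed

lemma form_product_commute: "form_product L1 L2 = form_product L2 L1"
  by (simp add: form_product_def vec_eq_iff forall_3)

lemma MD_form_commute: "MD_form u2 u1 = - MD_form u1 u2"
  by (simp add: MD_form_def form_product_commute[of "annihilator_form u2"] cross_flip[of u2]
      vec_eq_iff)

lemma is_Markoff_Davenport_form_cases:
  assumes A: "MCRS_group \<A>" and u: "u1 \<noteq> 0" "u2 \<noteq> 0"
    and hs: "has_eigenspaces \<A> (vec.span {complexify u1}) (vec.span {complexify u2})"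
    and \<Phi>: "is_Markoff_Davenport_form \<A> \<Phi>"
  shows "\<Phi> = MD_form u1 u2 \<or> \<Phi> = - MD_form u1 u2"
proof -
  obtain l1 l2 L1 L2 where l: "has_eigenspaces \<A> l1 l2" and L: "L1 \<noteq> 0" "L2 \<noteq> 0"
    "\<forall>v\<in>l2. linear_form L1 v = 0" "\<forall>v\<in>l1. linear_form L2 v = 0"
    and \<Phi>: "\<Phi> = inverse (form_det L1 L2) *s form_product L1 L2"
    using \<Phi> unfolding is_Markoff_Davenport_form_def by blast
  have key: "\<Phi> = - MD_form p q"
    if p: "p \<noteq> 0" "complexify p \<in> l1" and q: "q \<noteq> 0" "complexify q \<in> l2" for p q
  proof -
    obtain s where s: "L1 = s *s annihilator_form q"
      using linear_form_vanishing_multiple[OF q(1)] L q(2) by blast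
    obtain t where t: "L2 = t *s annihilator_form p"
      using linear_form_vanishing_multiple[OF p(1)] L p(2) by blast
    have st: "s \<noteq> 0" "t \<noteq> 0" using L s t by auto
    have "form_det L1 L2 = - (s * t) * complex_of_real (cross p q)"
      by (simp add: form_det_eq s t annihilator_form_def cross_def algebra_simps)
    moreover have "form_product L1 L2 = (s * t) *s form_product (annihilator_form p) (annihilator_form q)"
      by (simp add: s t form_product_def vec_eq_iff forall_3 algebra_simps)
    ultimately show ?thesis
      using st by (simp add: \<Phi> MD_form_def vec_eq_iff field_simps)
  qed
  have "l1 = vec.span {complexify u1} \<and> l2 = vec.span {complexify u2} \<or>
      l1 = vec.span {complexify u2} \<and> l2 = vec.span {complexify u1}"
    by (rule has_eigenspaces_unique[OF A hs l])
  then show ?thesis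
  proof
    assume "l1 = vec.span {complexify u1} \<and> l2 = vec.span {complexify u2}"
    then show ?thesis using key[of u1 u2] u by (simp add: vec.span_base)
  next
    assume "l1 = vec.span {complexify u2} \<and> l2 = vec.span {complexify u1}"
    then show ?thesis using key[of u2 u1] u by (simp add: vec.span_base MD_form_commute[of u2 u1])
  qed
qed

lemma MD_form_is_Markoff_Davenport_form:
  assumes u: "u1 \<noteq> 0" "u2 \<noteq> 0"
    and hs: "has_eigenspaces \<A> (vec.span {complexify u1}) (vec.span {complexify u2})"
  shows "is_Markoff_Davenport_form \<A> (MD_form u1 u2)"
  unfolding is_Markoff_Davenport_form_def
proof (intro exI conjI)
  show "has_eigenspaces \<A> (vec.span {complexify u2}) (vec.span {complexify u1})"
    using hs by (subst has_eigenspaces_commute)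
  show "annihilator_form u1 \<noteq> 0" "annihilator_form u2 \<noteq> 0"
    using u by (auto simp: annihilator_form_def vec_eq_iff forall_2)
  show "\<forall>v\<in>vec.span {complexify u1}. linear_form (annihilator_form u1) v = 0"
    "\<forall>v\<in>vec.span {complexify u2}. linear_form (annihilator_form u2) v = 0"
    by (auto simp: span_complexify linear_form_def annihilator_form_def)
  have "form_det (annihilator_form u1) (annihilator_form u2) = complex_of_real (cross u1 u2)"
    by (simp add: form_det_eq annihilator_form_def cross_def)
  then show "MD_form u1 u2 = inverse (form_det (annihilator_form u1) (annihilator_form u2)) *s
      form_product (annihilator_form u1) (annihilator_form u2)"
    by (simp add: MD_form_def)
qed

lemma discrepancy_eq:
  assumes A: "MCRS_group \<A>" "u1 \<noteq> 0" "u2 \<noteq> 0"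
      "has_eigenspaces \<A> (vec.span {complexify u1}) (vec.span {complexify u2})"
    and B: "MCRS_group \<B>" "w1 \<noteq> 0" "w2 \<noteq> 0"
      "has_eigenspaces \<B> (vec.span {complexify w1}) (vec.span {complexify w2})"
  shows "discrepancy \<A> \<B> = min (max_abs (MD_form u1 u2 + MD_form w1 w2))
    (max_abs (MD_form u1 u2 - MD_form w1 w2))"
  unfolding discrepancy_def
proof (rule the_equality)
  let ?F = "MD_form u1 u2" and ?G = "MD_form w1 w2"
  show "\<exists>\<Phi>1 \<Phi>2. is_Markoff_Davenport_form \<A> \<Phi>1 \<and> is_Markoff_Davenport_form \<B> \<Phi>2 \<and>
      min (max_abs (?F + ?G)) (max_abs (?F - ?G)) = min (max_abs (\<Phi>1 + \<Phi>2)) (max_abs (\<Phi>1 - \<Phi>2))"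
    using MD_form_is_Markoff_Davenport_form[OF A(2-4)]
      MD_form_is_Markoff_Davenport_form[OF B(2-4)] by blast
  fix r
  assume "\<exists>\<Phi>1 \<Phi>2. is_Markoff_Davenport_form \<A> \<Phi>1 \<and> is_Markoff_Davenport_form \<B> \<Phi>2 \<and>
      r = min (max_abs (\<Phi>1 + \<Phi>2)) (max_abs (\<Phi>1 - \<Phi>2))"
  then obtain \<Phi>1 \<Phi>2 where \<Phi>: "is_Markoff_Davenport_form \<A> \<Phi>1" "is_Markoff_Davenport_form \<B> \<Phi>2"
    and r: "r = min (max_abs (\<Phi>1 + \<Phi>2)) (max_abs (\<Phi>1 - \<Phi>2))" by blast
  note r is_Markoff_Davenport_form_cases[OF A \<Phi>(1)] is_Markoff_Davenport_form_cases[OF B \<Phi>(2)]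
  moreover have neg: "max_abs (- F + G) = max_abs (F - G)" "max_abs (- F - G) = max_abs (F + G)"
    for F G :: "complex^3"
    using max_abs_minus[of "F - G"] max_abs_minus[of "F + G"] by simp_all
  ultimately show "r = min (max_abs (?F + ?G)) (max_abs (?F - ?G))"
    by (elim disjE) (simp_all only: neg diff_minus_eq_add add_uminus_conv_diff min.commute)
qed

text \<open>
  The value of the Markoff-Davenport form at a real vector, as a real number.
\<close>
definition MD_value :: "real^2 \<Rightarrow> real^2 \<Rightarrow> real^2 \<Rightarrow> real" where
  "MD_value u1 u2 w = cross u1 w * cross u2 w / cross u1 u2"

definition integer_vector :: "real^2 \<Rightarrow> bool" where
  "integer_vector w \<longleftrightarrow> (\<forall>i. w $ i \<in> \<int>)"

text \<open>
  The form of \<open>\<B>\<close> vanishes at its eigenvectors \<open>v1\<close> and \<open>v2\<close>. At these points the form of \<open>\<A>\<close> thus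
  agrees with both the sum and the difference of the two forms.
\<close>
lemma MD_value_le_discrepancy:
  assumes A: "MCRS_group \<A>" "u1 \<noteq> 0" "u2 \<noteq> 0"
      "has_eigenspaces \<A> (vec.span {complexify u1}) (vec.span {complexify u2})"
    and B: "MCRS_group \<B>" "v1 \<noteq> 0" "v2 \<noteq> 0"
      "has_eigenspaces \<B> (vec.span {complexify v1}) (vec.span {complexify v2})"
    and v: "v = v1 \<or> v = v2"
  shows "\<bar>MD_value u1 u2 v\<bar> \<le> 3 * discrepancy \<A> \<B> * (max_abs (complexify v))\<^sup>2"
proof -
  let ?F = "MD_form u1 u2" and ?G = "MD_form v1 v2" and ?v = "complexify v"
  have G0: "quadratic_form ?G ?v = 0" using v by (auto simp: quadratic_MD_form)
  have F: "quadratic_form ?F ?v = complex_of_real (MD_value u1 u2 v)"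
    by (simp add: quadratic_MD_form MD_value_def)
  have "quadratic_form (?F + ?G) ?v = complex_of_real (MD_value u1 u2 v)"
    "quadratic_form (?F - ?G) ?v = complex_of_real (MD_value u1 u2 v)"
    by (simp_all only: quadratic_form_add quadratic_form_diff G0 F add_0_right diff_0_right)
  then have "\<bar>MD_value u1 u2 v\<bar> \<le> 3 * max_abs (?F + ?G) * (max_abs ?v)\<^sup>2"
    "\<bar>MD_value u1 u2 v\<bar> \<le> 3 * max_abs (?F - ?G) * (max_abs ?v)\<^sup>2"
    using norm_quadratic_form_le[of "?F + ?G" ?v] norm_quadratic_form_le[of "?F - ?G" ?v] by simp_all
  then show ?thesis unfolding discrepancy_eq[OF A B] by (simp add: min_def)
qed

lemma MD_value_le: "\<bar>MD_value u1 u2 v\<bar> \<le> 3 * max_abs (MD_form u1 u2) * (max_abs (complexify v))\<^sup>2"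
  using norm_quadratic_form_le[of "MD_form u1 u2" "complexify v"]
  by (simp only: quadratic_MD_form MD_value_def norm_of_real)


section \<open>Good rational approximations\<close>

text \<open>
  Dirichlet's theorem applied to the slope of \<open>u\<close>. Dividing by the larger coordinate keeps the slope in
  \<open>[-1, 1]\<close>, so that numerator and denominator are both at most \<open>N\<close>.
\<close>
lemma dirichlet_primitive_vector:
  assumes u: "u \<noteq> 0" and N: "N \<ge> (1::nat)"
  obtains w where "primitive (complexify w)" "max_abs (complexify w) \<le> N"
    "\<bar>cross u w\<bar> \<le> (\<bar>u $ 1\<bar> + \<bar>u $ 2\<bar>) / N"
proof -
  have approx: "\<exists>h k. coprime h k \<and> \<bar>h\<bar> \<le> int N \<and> \<bar>k\<bar> \<le> int N \<and> \<bar>of_int k * \<theta> - of_int h\<bar> \<le> 1 / N"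
    if \<theta>: "\<bar>\<theta>\<bar> \<le> 1" for \<theta> :: real
  proof -
    obtain h k where hk: "coprime h k" "0 < k" "k \<le> int N" "\<bar>of_int k * \<theta> - of_int h\<bar> < 1 / N"
      using Dirichlet_approx_coprime[of N \<theta>] N by auto
    have "\<bar>of_int k * \<theta>\<bar> \<le> of_int k"
      using \<theta> hk(2) by (simp add: abs_mult mult_left_le)
    moreover have "1 / real N \<le> 1" using N by simp
    ultimately have "\<bar>real_of_int h\<bar> < of_int k + 1" using hk(4) by linarith
    then have "\<bar>h\<bar> \<le> k" by linarith
    then show ?thesis using hk by (intro exI[of _ h] exI[of _ k]) auto
  qed
  show thesis
  proof (cases "\<bar>u $ 1\<bar> \<le> \<bar>u $ 2\<bar>")
    case True
    then have u2: "u $ 2 \<noteq> 0" using u by (auto simp: vec_eq_iff forall_2)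
    obtain h k where hk: "coprime h k" "\<bar>h\<bar> \<le> int N" "\<bar>k\<bar> \<le> int N"
      "\<bar>of_int k * (u $ 1 / u $ 2) - of_int h\<bar> \<le> 1 / N"
      using approx[of "u $ 1 / u $ 2"] True u2 by (auto simp: abs_divide)
    define w :: "real^2" where "w = vector [of_int h, of_int k]"
    have "cross u w = u $ 2 * (of_int k * (u $ 1 / u $ 2) - of_int h)"
      using u2 by (simp add: cross_def w_def field_simps)
    then have "\<bar>cross u w\<bar> \<le> \<bar>u $ 2\<bar> * (1 / N)"
      unfolding abs_mult using hk(4) by (simp only: abs_mult mult_left_mono abs_ge_zero)
    also have "\<dots> \<le> (\<bar>u $ 1\<bar> + \<bar>u $ 2\<bar>) / N" by (simp add: divide_right_mono)
    finally have 1: "\<bar>cross u w\<bar> \<le> (\<bar>u $ 1\<bar> + \<bar>u $ 2\<bar>) / N" .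
    have "\<bar>real_of_int h\<bar> \<le> real N" "\<bar>real_of_int k\<bar> \<le> real N" using hk(2,3) by linarith+
    then have 2: "max_abs (complexify w) \<le> N"
      by (simp add: max_abs_complexify_le_iff forall_2 w_def)
    have 3: "primitive (complexify w)"
      by (rule primitive_complexify_coprime[OF _ _ hk(1)]) (simp_all add: w_def)
    show thesis by (rule that[OF 3 2 1])
  next
    case False
    then have u1: "u $ 1 \<noteq> 0" by auto
    obtain h k where hk: "coprime h k" "\<bar>h\<bar> \<le> int N" "\<bar>k\<bar> \<le> int N"
      "\<bar>of_int k * (u $ 2 / u $ 1) - of_int h\<bar> \<le> 1 / N"
      using approx[of "u $ 2 / u $ 1"] False u1 by (auto simp: abs_divide)
    define w :: "real^2" where "w = vector [of_int k, of_int h]"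
    have "cross u w = - (u $ 1 * (of_int k * (u $ 2 / u $ 1) - of_int h))"
      using u1 by (simp add: cross_def w_def field_simps)
    then have "\<bar>cross u w\<bar> \<le> \<bar>u $ 1\<bar> * (1 / N)"
      using hk(4) by (simp only: abs_minus_cancel abs_mult mult_left_mono abs_ge_zero)
    also have "\<dots> \<le> (\<bar>u $ 1\<bar> + \<bar>u $ 2\<bar>) / N" by (simp add: divide_right_mono)
    finally have 1: "\<bar>cross u w\<bar> \<le> (\<bar>u $ 1\<bar> + \<bar>u $ 2\<bar>) / N" .
    have "\<bar>real_of_int h\<bar> \<le> real N" "\<bar>real_of_int k\<bar> \<le> real N" using hk(2,3) by linarith+
    then have 2: "max_abs (complexify w) \<le> N"
      by (simp add: max_abs_complexify_le_iff forall_2 w_def)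
    have 3: "primitive (complexify w)"
      using hk(1) by (intro primitive_complexify_coprime[of w k h])
        (simp_all add: w_def coprime_commute)
    show thesis by (rule that[OF 3 2 1])
  qed
qed

lemma MD_form_scale:
  assumes "s \<noteq> 0" "t \<noteq> 0"
  shows "MD_form (s *\<^sub>R u1) (t *\<^sub>R u2) = MD_form u1 u2"
proof -
  have "form_product (annihilator_form (s *\<^sub>R u1)) (annihilator_form (t *\<^sub>R u2))
      = complex_of_real (s * t) *s form_product (annihilator_form u1) (annihilator_form u2)"
    by (simp add: form_product_def annihilator_form_def vec_eq_iff forall_3 algebra_simps)
  then show ?thesis
    using assms by (simp add: MD_form_def cross_simps vector_smult_assoc field_simps)
qed

text \<open>
  With the products \<open>f\<^sub>i\<^sub>j\<close> of the forms annihilating \<open>u\<^sub>i\<close> and \<open>u\<^sub>j\<close>, bilinearity turns the perturbed form into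
  \<open>((1 + e1 e2) f\<^sub>1\<^sub>2 + e2 f\<^sub>1\<^sub>1 + e1 f\<^sub>2\<^sub>2) / (cross u1 u2 * (1 - e1 e2))\<close>, which is \<open>O(e)\<close> away from
  \<open>f\<^sub>1\<^sub>2 / cross u1 u2\<close>.
\<close>
lemma MD_form_perturbation:
  assumes D: "cross u1 u2 \<noteq> 0"
  obtains P where "P > 0" and
    "\<And>e e1 e2. \<bar>e1\<bar> \<le> e \<Longrightarrow> \<bar>e2\<bar> \<le> e \<Longrightarrow> e \<le> 1/2 \<Longrightarrow>
      max_abs (MD_form u1 u2 - MD_form (u1 + e1 *\<^sub>R u2) (u2 + e2 *\<^sub>R u1)) \<le> P * e"
proof -
  let ?D = "cross u1 u2"
  let ?f = "\<lambda>x y. form_product (annihilator_form x) (annihilator_form y)"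
  define Q where "Q = max_abs (?f u1 u1) + max_abs (?f u1 u2) + max_abs (?f u2 u2) + 1"
  have Q0: "Q > 0" using max_abs_nonneg[of "?f u1 u1"] max_abs_nonneg[of "?f u1 u2"]
      max_abs_nonneg[of "?f u2 u2"] by (simp add: Q_def)
  have Q: "norm (?f u1 u1 $ i) \<le> Q" "norm (?f u1 u2 $ i) \<le> Q" "norm (?f u2 u2 $ i) \<le> Q" for i
    using norm_nth_le_max_abs[of "?f u1 u1" i] norm_nth_le_max_abs[of "?f u1 u2" i]
      norm_nth_le_max_abs[of "?f u2 u2" i] max_abs_nonneg[of "?f u1 u1"]
      max_abs_nonneg[of "?f u1 u2"] max_abs_nonneg[of "?f u2 u2"] by (simp_all add: Q_def)
  show thesis
  proof (rule that)
    show "4 * Q / \<bar>?D\<bar> > 0" using Q0 D by simp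
    fix e e1 e2 :: real
    assume e: "\<bar>e1\<bar> \<le> e" "\<bar>e2\<bar> \<le> e" "e \<le> 1/2"
    then have e0: "0 \<le> e" by linarith
    have "\<bar>e1 * e2\<bar> \<le> e * (1/2)" unfolding abs_mult using e e0 by (intro mult_mono) auto
    then have ee: "\<bar>e1 * e2\<bar> \<le> e/2" "\<bar>e1 * e2\<bar> \<le> 1/4" using e by simp_all
    then have den: "1 - e1 * e2 \<ge> 3/4" by linarith
    have "cross (u1 + e1 *\<^sub>R u2) (u2 + e2 *\<^sub>R u1) = ?D * (1 - e1 * e2)"
      by (simp add: cross_simps cross_flip[of u2 u1] algebra_simps)
    note cr = this
    have "norm ((MD_form u1 u2 - MD_form (u1 + e1 *\<^sub>R u2) (u2 + e2 *\<^sub>R u1)) $ i)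
        \<le> 4 * Q / \<bar>?D\<bar> * e" for i
    proof -
      let ?c = complex_of_real
      let ?num = "2 * ?c (e1 * e2) * ?f u1 u2 $ i + ?c e2 * ?f u1 u1 $ i + ?c e1 * ?f u2 u2 $ i"
      have expand: "?f (u1 + e1 *\<^sub>R u2) (u2 + e2 *\<^sub>R u1) $ i
          = (1 + ?c (e1 * e2)) * ?f u1 u2 $ i + ?c e2 * ?f u1 u1 $ i + ?c e1 * ?f u2 u2 $ i"
        using exhaust_3[of i] by (auto simp: form_product_def annihilator_form_def algebra_simps)
      have c1: "?c ?D \<noteq> 0" using D by simp
      have "1 - e1 * e2 \<noteq> 0" using den by linarith
      then have c2: "1 - ?c (e1 * e2) \<noteq> 0"
        by (metis of_real_1 of_real_diff of_real_eq_0_iff)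
      have "1 - ?c (e1 * e2) = ?c (1 - e1 * e2)" by simp
      then have den_norm: "norm (1 - ?c (e1 * e2)) = \<bar>1 - e1 * e2\<bar>" by (simp only: norm_of_real)
      have alg: "inverse d * x - inverse (d * (1 - p)) * ((1 + p) * x + y) = - (2 * p * x + y) / (d * (1 - p))"
        if "d \<noteq> 0" "1 - p \<noteq> 0" for d p x y :: complex
        using that by (simp add: divide_simps) (simp add: algebra_simps)
      have "(MD_form u1 u2 - MD_form (u1 + e1 *\<^sub>R u2) (u2 + e2 *\<^sub>R u1)) $ i
          = - ?num / (?c ?D * (1 - ?c (e1 * e2)))"
        using alg[OF c1 c2, of "?f u1 u2 $ i" "?c e2 * ?f u1 u1 $ i + ?c e1 * ?f u2 u2 $ i"]
        by (simp add: MD_form_def cr expand add.assoc)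
      then have "norm ((MD_form u1 u2 - MD_form (u1 + e1 *\<^sub>R u2) (u2 + e2 *\<^sub>R u1)) $ i)
          = norm ?num / (\<bar>?D\<bar> * \<bar>1 - e1 * e2\<bar>)"
        by (simp only: norm_divide norm_mult[of "?c ?D"] norm_minus_cancel norm_of_real den_norm)
      also have "\<dots> \<le> (3 * e * Q) / (\<bar>?D\<bar> * (3/4))"
      proof (intro frac_le mult_left_mono)
        have "norm ?num \<le> norm (2 * ?c (e1 * e2) * ?f u1 u2 $ i) + norm (?c e2 * ?f u1 u1 $ i)
            + norm (?c e1 * ?f u2 u2 $ i)"
          by (intro order_trans[OF norm_triangle_ineq] add_mono order_refl norm_triangle_ineq)
        also have "norm (2 * ?c (e1 * e2) * ?f u1 u2 $ i) = 2 * \<bar>e1 * e2\<bar> * norm (?f u1 u2 $ i)"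
          by (simp add: norm_mult abs_mult)
        also have "\<dots> \<le> e * Q" using ee Q e0 by (intro mult_mono) auto
        also have "norm (?c e2 * ?f u1 u1 $ i) \<le> e * Q"
          unfolding norm_mult norm_of_real using e Q e0 by (intro mult_mono) auto
        also have "norm (?c e1 * ?f u2 u2 $ i) \<le> e * Q"
          unfolding norm_mult norm_of_real using e Q e0 by (intro mult_mono) auto
        finally show "norm ?num \<le> 3 * e * Q" by (simp add: mult.commute mult.left_commute)
        show "0 \<le> 3 * e * Q" using e0 Q0 by simp
        show "0 < \<bar>?D\<bar> * (3/4)" using D by simp
        show "3/4 \<le> \<bar>1 - e1 * e2\<bar>" using den by linarith
      qed simp
      also have "\<dots> = 4 * Q / \<bar>?D\<bar> * e" by (simp add: field_simps)
      finally show ?thesis .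
    qed
    then show "max_abs (MD_form u1 u2 - MD_form (u1 + e1 *\<^sub>R u2) (u2 + e2 *\<^sub>R u1)) \<le> 4 * Q / \<bar>?D\<bar> * e"
      by (simp only: max_abs_le_iff simp_thms)
  qed
qed

text \<open>
  Write \<open>w1 = s (u1 + e1 u2)\<close> with \<open>\<bar>e1\<bar> = \<bar>cross u1 w1\<bar> / \<bar>cross u2 w1\<bar>\<close>. Dirichlet's theorem makes
  the numerator \<open>O(1/N)\<close>. The lower bound on the form, which is the product of numerator and
  denominator up to a constant, then forces the denominator to be of order at least \<open>N\<close>, so
  \<open>e1 = O(1/N\<^sup>2)\<close>. The same holds for \<open>w2\<close>.
\<close>
lemma good_rational_approximation:
  assumes D: "cross u1 u2 \<noteq> 0" and c: "c > 0"
    and bad: "\<And>w. integer_vector w \<Longrightarrow> w \<noteq> 0 \<Longrightarrow> c \<le> \<bar>MD_value u1 u2 w\<bar>"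
  obtains K N0 where "K > 0" "N0 > 0"
    "\<And>N. N \<ge> N0 \<Longrightarrow> \<exists>w1 w2. primitive (complexify w1) \<and> primitive (complexify w2) \<and>
      max_abs (complexify w1) \<le> real N \<and> max_abs (complexify w2) \<le> real N \<and> cross w1 w2 \<noteq> 0 \<and>
      max_abs (MD_form u1 u2 - MD_form w1 w2) \<le> K / (real N)\<^sup>2"
proof -
  have u: "u1 \<noteq> 0" "u2 \<noteq> 0" using D by (auto simp: cross_def)
  define a where "a = \<bar>u1 $ 1\<bar> + \<bar>u1 $ 2\<bar> + \<bar>u2 $ 1\<bar> + \<bar>u2 $ 2\<bar>"
  have a0: "a > 0" using u(1) by (auto simp: a_def vec_eq_iff forall_2)
  define L where "L = a\<^sup>2 / (c * \<bar>cross u1 u2\<bar>)"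
  have L0: "L > 0" using a0 c D by (simp add: L_def)
  obtain P where P: "P > 0" "\<And>e e1 e2. \<bar>e1\<bar> \<le> e \<Longrightarrow> \<bar>e2\<bar> \<le> e \<Longrightarrow> e \<le> 1/2 \<Longrightarrow>
      max_abs (MD_form u1 u2 - MD_form (u1 + e1 *\<^sub>R u2) (u2 + e2 *\<^sub>R u1)) \<le> P * e"
    using MD_form_perturbation[OF D] by blast
  \<comment> \<open>\<open>x\<close> is the small coordinate and \<open>y\<close> the large one.\<close>
  have ratio: "x \<noteq> 0 \<and> y \<noteq> 0 \<and> \<bar>x / y\<bar> \<le> L / (real N)\<^sup>2"
    if x: "\<bar>x\<bar> \<le> a / real N" and xy: "c * \<bar>cross u1 u2\<bar> \<le> \<bar>x\<bar> * \<bar>y\<bar>" and N: "N > 0" for x y N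
  proof -
    have cD: "c * \<bar>cross u1 u2\<bar> > 0" using c D by simp
    then have "\<bar>x\<bar> * \<bar>y\<bar> > 0" using xy by linarith
    then have nz: "x \<noteq> 0" "y \<noteq> 0" by auto
    have "\<bar>x\<bar> * \<bar>x\<bar> \<le> (a / real N) * (a / real N)" using x by (intro mult_mono) auto
    also have "\<dots> = L * (c * \<bar>cross u1 u2\<bar>) / (real N)\<^sup>2"
      using c D by (simp add: L_def power2_eq_square)
    also have "\<dots> \<le> L * (\<bar>x\<bar> * \<bar>y\<bar>) / (real N)\<^sup>2"
      using xy L0 by (intro divide_right_mono mult_left_mono) auto
    finally have "\<bar>x\<bar> * \<bar>x\<bar> \<le> \<bar>x\<bar> * (L / (real N)\<^sup>2 * \<bar>y\<bar>)" by (simp add: algebra_simps)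
    then have "\<bar>x\<bar> \<le> L / (real N)\<^sup>2 * \<bar>y\<bar>" 
      by (rule mult_left_le_imp_le) (use nz in simp)
    then have "\<bar>x\<bar> / \<bar>y\<bar> \<le> L / (real N)\<^sup>2" 
      using nz by (simp add: divide_le_eq)
    then show ?thesis using nz by (simp add: abs_divide)
  qed
  show thesis
  proof (rule that)
    show "P * L > 0" using P(1) L0 by simp
    \<comment> \<open>From this \<open>N\<close> on, the perturbation \<open>L / N\<^sup>2\<close> is at most \<open>1/2\<close>.\<close>
    show "nat \<lceil>2 * L\<rceil> + 1 > 0" by simp
    fix N assume N0: "N \<ge> nat \<lceil>2 * L\<rceil> + 1"
    then have N: "N \<ge> 1" "2 * L \<le> real N" by linarith+
    have "real N \<le> (real N)\<^sup>2" using N by (simp add: power2_eq_square)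
    then have "2 * L \<le> (real N)\<^sup>2" using N(2) by linarith
    then have small: "L / (real N)\<^sup>2 \<le> 1/2" using N(1) by (simp add: divide_le_eq)
    have "(\<bar>u1 $ 1\<bar> + \<bar>u1 $ 2\<bar>) / real N \<le> a / real N" "(\<bar>u2 $ 1\<bar> + \<bar>u2 $ 2\<bar>) / real N \<le> a / real N"
      by (simp_all add: a_def divide_right_mono)
    note le_a = order_trans[OF _ this(1)] order_trans[OF _ this(2)]
    obtain w1 where w1: "primitive (complexify w1)" "max_abs (complexify w1) \<le> N"
      "\<bar>cross u1 w1\<bar> \<le> a / real N"
      using dirichlet_primitive_vector[OF u(1) N(1)] le_a(1) by metis
    obtain w2 where w2: "primitive (complexify w2)" "max_abs (complexify w2) \<le> N"
      "\<bar>cross u2 w2\<bar> \<le> a / real N"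
      using dirichlet_primitive_vector[OF u(2) N(1)] le_a(2) by metis
    have prod: "c * \<bar>cross u1 u2\<bar> \<le> \<bar>cross u1 w\<bar> * \<bar>cross u2 w\<bar>" if "primitive (complexify w)" for w
    proof -
      have "c \<le> \<bar>MD_value u1 u2 w\<bar>"
        using primitive_complexify_integral[OF that] primitive_nonzero[OF that]
        by (intro bad) (simp_all add: integer_vector_def)
      then show ?thesis using D by (simp add: MD_value_def abs_mult abs_divide pos_le_divide_eq)
    qed
    define e1 where "e1 = cross u1 w1 / cross w1 u2"
    define e2 where "e2 = cross w2 u2 / cross u1 w2"
    have r1: "cross w1 u2 \<noteq> 0" "\<bar>e1\<bar> \<le> L / (real N)\<^sup>2"
      using ratio[OF w1(3), of "cross w1 u2"] prod[OF w1(1)] N(1)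
      by (simp_all add: e1_def cross_flip[of w1 u2])
    have r2: "cross u1 w2 \<noteq> 0" "\<bar>e2\<bar> \<le> L / (real N)\<^sup>2"
      using ratio[of "cross w2 u2" N "cross u1 w2"] w2(3) prod[OF w2(1)] N(1)
      by (simp_all add: e2_def cross_flip[of w2 u2] mult.commute)
    define s where "s = cross w1 u2 / cross u1 u2"
    define t where "t = cross u1 w2 / cross u1 u2"
    have st: "s \<noteq> 0" "t \<noteq> 0" using r1 r2 D by (simp_all add: s_def t_def)
    have se: "s * e1 = cross u1 w1 / cross u1 u2" and te: "t * e2 = cross w2 u2 / cross u1 u2"
      using r1(1) r2(1) by (simp_all add: s_def t_def e1_def e2_def)
    have "w1 = s *\<^sub>R u1 + (s * e1) *\<^sub>R u2" "w2 = (t * e2) *\<^sub>R u1 + t *\<^sub>R u2"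
      unfolding se te unfolding s_def t_def by (rule cross_basis_expansion[OF D])+
    then have W: "w1 = s *\<^sub>R (u1 + e1 *\<^sub>R u2)" "w2 = t *\<^sub>R (u2 + e2 *\<^sub>R u1)"
      by (simp_all only: scaleR_add_right scaleR_scaleR add.commute)
    have "max_abs (MD_form u1 u2 - MD_form w1 w2) \<le> P * (L / (real N)\<^sup>2)"
      unfolding W MD_form_scale[OF st] by (rule P(2)[OF r1(2) r2(2) small])
    moreover have "cross w1 w2 \<noteq> 0"
    proof -
      have "\<bar>e1\<bar> \<le> 1/2" "\<bar>e2\<bar> \<le> 1/2" using r1(2) r2(2) small by linarith+
      then have "\<bar>e1 * e2\<bar> \<le> 1/2 * (1/2)"
        unfolding abs_mult by (intro mult_mono) auto
      then have "1 - e1 * e2 \<noteq> 0" by linarith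
      moreover have "cross w1 w2 = s * t * (cross u1 u2 * (1 - e1 * e2))"
        by (simp add: W cross_simps cross_flip[of u2 u1] algebra_simps)
      ultimately show ?thesis using st D by simp
    qed
    ultimately show "\<exists>w1 w2. primitive (complexify w1) \<and> primitive (complexify w2) \<and>
      max_abs (complexify w1) \<le> real N \<and> max_abs (complexify w2) \<le> real N \<and> cross w1 w2 \<noteq> 0 \<and>
      max_abs (MD_form u1 u2 - MD_form w1 w2) \<le> P * L / (real N)\<^sup>2"
      using w1 w2 by auto
  qed
qed


section \<open>Depth of sails in terms of the form\<close>

lemma closed_cone_commute: "closed_cone u1 u2 = closed_cone u2 u1"
  unfolding closed_cone_def by (metis (no_types, opaque_lifting) add.commute)

lemma closed_cone_scale_subset:
  assumes "s > 0" "t > 0"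
  shows "closed_cone (s *\<^sub>R u1) (t *\<^sub>R u2) \<subseteq> closed_cone u1 u2"
proof
  fix w assume "w \<in> closed_cone (s *\<^sub>R u1) (t *\<^sub>R u2)"
  then obtain a b where "w = a *\<^sub>R (s *\<^sub>R u1) + b *\<^sub>R (t *\<^sub>R u2)" "0 \<le> a" "0 \<le> b"
    by (auto simp: closed_cone_def)
  then have "w = (a * s) *\<^sub>R u1 + (b * t) *\<^sub>R u2" "0 \<le> a * s" "0 \<le> b * t"
    using assms by simp_all
  then show "w \<in> closed_cone u1 u2" unfolding closed_cone_def by blast
qed

lemma closed_cone_scale:
  assumes "s \<noteq> 0" "t \<noteq> 0"
  shows "closed_cone (s *\<^sub>R u1) (t *\<^sub>R u2) = closed_cone (sgn s *\<^sub>R u1) (sgn t *\<^sub>R u2)"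
proof
  have e: "s *\<^sub>R u1 = \<bar>s\<bar> *\<^sub>R (sgn s *\<^sub>R u1)" "t *\<^sub>R u2 = \<bar>t\<bar> *\<^sub>R (sgn t *\<^sub>R u2)"
    by (simp_all add: abs_mult_sgn)
  show "closed_cone (s *\<^sub>R u1) (t *\<^sub>R u2) \<subseteq> closed_cone (sgn s *\<^sub>R u1) (sgn t *\<^sub>R u2)"
    unfolding e using assms by (intro closed_cone_scale_subset) auto
  have e': "sgn s *\<^sub>R u1 = (1/\<bar>s\<bar>) *\<^sub>R (s *\<^sub>R u1)" "sgn t *\<^sub>R u2 = (1/\<bar>t\<bar>) *\<^sub>R (t *\<^sub>R u2)"
    by (simp_all add: sgn_if assms)
  show "closed_cone (sgn s *\<^sub>R u1) (sgn t *\<^sub>R u2) \<subseteq> closed_cone (s *\<^sub>R u1) (t *\<^sub>R u2)"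
    unfolding e' using assms by (intro closed_cone_scale_subset) auto
qed

text \<open>
  The eigenlines determine the spanning vectors of a cone up to order and nonzero factors, and only
  the signs of the factors matter.
\<close>
lemma eigencone_cases:
  assumes A: "MCRS_group \<A>" "u1 \<noteq> 0" "u2 \<noteq> 0"
      "has_eigenspaces \<A> (vec.span {complexify u1}) (vec.span {complexify u2})"
    and K: "K \<in> eigencones \<A>"
  obtains \<sigma> \<tau> where "\<bar>\<sigma>\<bar> = 1" "\<bar>\<tau>\<bar> = 1" "K = closed_cone (\<sigma> *\<^sub>R u1) (\<tau> *\<^sub>R u2)"
proof -
  obtain p q where pq: "p \<noteq> 0" "q \<noteq> 0" "K = closed_cone p q"
    and hs: "has_eigenspaces \<A> (vec.span {complexify p}) (vec.span {complexify q})"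
    using K by (auto simp: eigencones_def)
  note conclude = that
  have key: thesis
    if x: "x \<noteq> 0" and y: "y \<noteq> 0" and Kxy: "K = closed_cone x y"
      and sp: "vec.span {complexify x} = vec.span {complexify u1}"
        "vec.span {complexify y} = vec.span {complexify u2}" for x y
  proof -
    have "cross u1 x = 0" "cross u2 y = 0"
      using span_complexify_eq_iff[OF A(2) x] span_complexify_eq_iff[OF A(3) y] sp by simp_all
    then obtain s t where st: "x = s *\<^sub>R u1" "y = t *\<^sub>R u2"
      using cross_eq_0_parallel A(2,3) by metis
    have nz: "s \<noteq> 0" "t \<noteq> 0" using x y st by auto
    show thesis
      by (rule conclude[of "sgn s" "sgn t"])
        (simp_all add: Kxy st closed_cone_scale[OF nz] nz abs_sgn_eq)
  qed
  from has_eigenspaces_unique[OF A(1) A(4) hs] show thesis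
  proof
    assume "vec.span {complexify p} = vec.span {complexify u1} \<and>
      vec.span {complexify q} = vec.span {complexify u2}"
    then show thesis using key[OF pq] by blast
  next
    assume "vec.span {complexify p} = vec.span {complexify u2} \<and>
      vec.span {complexify q} = vec.span {complexify u1}"
    then show thesis using key[OF pq(2) pq(1)] pq(3) closed_cone_commute[of p q] by metis
  qed
qed

text \<open>
  The coordinates of \<open>w\<close> in the basis \<open>u1\<close>, \<open>u2\<close>; see \<open>cross_basis_expansion\<close>.
\<close>
definition coord1 :: "real^2 \<Rightarrow> real^2 \<Rightarrow> real^2 \<Rightarrow> real" where
  "coord1 u1 u2 w = cross w u2 / cross u1 u2"

definition coord2 :: "real^2 \<Rightarrow> real^2 \<Rightarrow> real^2 \<Rightarrow> real" where
  "coord2 u1 u2 w = cross u1 w / cross u1 u2"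

text \<open>
  On an eigencone the signs of the coordinates are constant, so the weighted sum of their absolute values
  is a linear functional there, to which \<open>sail_depth_le_card\<close> applies. The same set \<open>S\<close> serves all
  four cones.
\<close>
lemma sail_depth_le_card_coords:
  assumes D: "cross u1 u2 \<noteq> 0" and st: "\<bar>\<sigma>\<bar> = 1" "\<bar>\<tau>\<bar> = 1"
    and v: "v \<in> sail (closed_cone (\<sigma> *\<^sub>R u1) (\<tau> *\<^sub>R u2)) k"
    and pq: "p > 0" "q > (0::real)"
    and r: "p * \<bar>coord1 u1 u2 v\<bar> + q * \<bar>coord2 u1 u2 v\<bar> < r"
    and fin: "finite S"
    and S: "\<And>w. integer_vector w \<Longrightarrow> p * \<bar>coord1 u1 u2 w\<bar> + q * \<bar>coord2 u1 u2 w\<bar> \<le> r \<Longrightarrow> w \<in> S"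
  shows "k \<le> card S"
proof -
  let ?K = "closed_cone (\<sigma> *\<^sub>R u1) (\<tau> *\<^sub>R u2)"
  define h :: "real^2" where "h = vector
    [(p * \<sigma> * u2 $ 2 - q * \<tau> * u1 $ 2) / cross u1 u2, (q * \<tau> * u1 $ 1 - p * \<sigma> * u2 $ 1) / cross u1 u2]"
  have h: "h \<bullet> w = p * \<sigma> * coord1 u1 u2 w + q * \<tau> * coord2 u1 u2 w" for w
    by (simp add: h_def inner_vec_def sum_2 coord1_def coord2_def cross_def[of w] cross_def[of _ w]
        diff_divide_distrib algebra_simps)
  have "h \<bullet> u1 = p * \<sigma>" using D by (simp add: h coord1_def coord2_def)
  then have "h \<noteq> 0" using pq st(1) by auto
  have "x * y \<le> \<bar>y\<bar>" if "\<bar>x\<bar> = 1" for x y :: real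
    using that by (metis abs_ge_self abs_mult mult_1)
  then have "\<sigma> * coord1 u1 u2 v \<le> \<bar>coord1 u1 u2 v\<bar>" "\<tau> * coord2 u1 u2 v \<le> \<bar>coord2 u1 u2 v\<bar>"
    using st by blast+
  then have "p * (\<sigma> * coord1 u1 u2 v) + q * (\<tau> * coord2 u1 u2 v)
      \<le> p * \<bar>coord1 u1 u2 v\<bar> + q * \<bar>coord2 u1 u2 v\<bar>"
    using pq by (intro add_mono mult_left_mono) auto
  then have hv: "h \<bullet> v < r" using r by (simp add: h mult.assoc)
  have sub: "{w \<in> integer_points ?K. h \<bullet> w \<le> r} \<subseteq> S"
  proof
    fix w assume w: "w \<in> {w \<in> integer_points ?K. h \<bullet> w \<le> r}"
    then obtain a b where ab: "w = a *\<^sub>R (\<sigma> *\<^sub>R u1) + b *\<^sub>R (\<tau> *\<^sub>R u2)" "0 \<le> a" "0 \<le> b"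
      by (auto simp: integer_points_def closed_cone_def)
    have "coord1 u1 u2 w = a * \<sigma>" "coord2 u1 u2 w = b * \<tau>"
      using D by (simp_all add: coord1_def coord2_def ab cross_simps)
    moreover have "\<sigma> * \<sigma> = 1" "\<tau> * \<tau> = 1" using st by (metis abs_mult_self_eq mult_1)+
    ultimately have "\<sigma> * coord1 u1 u2 w = \<bar>coord1 u1 u2 w\<bar>" "\<tau> * coord2 u1 u2 w = \<bar>coord2 u1 u2 w\<bar>"
      using ab st by (simp_all add: abs_mult algebra_simps)
    then have "h \<bullet> w = p * \<bar>coord1 u1 u2 w\<bar> + q * \<bar>coord2 u1 u2 w\<bar>"
      by (simp add: h mult.assoc)
    then show "w \<in> S" using w by (intro S) (auto simp: integer_points_def integer_vector_def)
  qed
  have "k \<le> card {w \<in> integer_points ?K. h \<bullet> w \<le> r}"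
    using v \<open>h \<noteq> 0\<close> hv finite_subset[OF sub fin] by (rule sail_depth_le_card)
  also have "\<dots> \<le> card S" using fin sub by (rule card_mono)
  finally show ?thesis .
qed

lemma abs_coord_le:
  "\<bar>coord1 u1 u2 w\<bar> \<le> (\<bar>u2 $ 1\<bar> + \<bar>u2 $ 2\<bar>) / \<bar>cross u1 u2\<bar> * max_abs (complexify w)"
  "\<bar>coord2 u1 u2 w\<bar> \<le> (\<bar>u1 $ 1\<bar> + \<bar>u1 $ 2\<bar>) / \<bar>cross u1 u2\<bar> * max_abs (complexify w)"
proof -
  have w: "\<bar>w $ i\<bar> \<le> max_abs (complexify w)" for i
    using norm_nth_le_max_abs[of "complexify w" i] by simp
  have "\<bar>cross w u2\<bar> \<le> \<bar>u2 $ 2\<bar> * \<bar>w $ 1\<bar> + \<bar>u2 $ 1\<bar> * \<bar>w $ 2\<bar>"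
    unfolding cross_def by (simp add: abs_mult[symmetric] mult.commute abs_triangle_ineq4)
  also have "\<dots> \<le> \<bar>u2 $ 2\<bar> * max_abs (complexify w) + \<bar>u2 $ 1\<bar> * max_abs (complexify w)"
    by (intro add_mono mult_left_mono w abs_ge_zero)
  finally show "\<bar>coord1 u1 u2 w\<bar> \<le> (\<bar>u2 $ 1\<bar> + \<bar>u2 $ 2\<bar>) / \<bar>cross u1 u2\<bar> * max_abs (complexify w)"
    by (simp add: coord1_def abs_divide divide_right_mono algebra_simps flip: add_divide_distrib)
  have "\<bar>cross u1 w\<bar> \<le> \<bar>u1 $ 1\<bar> * \<bar>w $ 2\<bar> + \<bar>u1 $ 2\<bar> * \<bar>w $ 1\<bar>"
    unfolding cross_def by (simp add: abs_mult[symmetric] abs_triangle_ineq4)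
  also have "\<dots> \<le> \<bar>u1 $ 1\<bar> * max_abs (complexify w) + \<bar>u1 $ 2\<bar> * max_abs (complexify w)"
    by (intro add_mono mult_left_mono w abs_ge_zero)
  finally show "\<bar>coord2 u1 u2 w\<bar> \<le> (\<bar>u1 $ 1\<bar> + \<bar>u1 $ 2\<bar>) / \<bar>cross u1 u2\<bar> * max_abs (complexify w)"
    by (simp add: coord2_def abs_divide divide_right_mono algebra_simps flip: add_divide_distrib)
qed

lemma finite_integer_vectors_bounded:
  "finite {w. integer_vector w \<and> (\<forall>i. \<bar>w $ i\<bar> \<le> R)}"
proof (rule finite_subset)
  let ?I = "real_of_int ` {-\<lceil>R\<rceil>..\<lceil>R\<rceil>}"
  let ?f = "\<lambda>(x, y). vector [x, y] :: real^2"
  show "finite (?f ` (?I \<times> ?I))" by simp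
  show "{w. integer_vector w \<and> (\<forall>i. \<bar>w $ i\<bar> \<le> R)} \<subseteq> ?f ` (?I \<times> ?I)"
  proof
    fix w :: "real^2" assume w: "w \<in> {w. integer_vector w \<and> (\<forall>i. \<bar>w $ i\<bar> \<le> R)}"
    have "w $ i \<in> ?I" for i
    proof -
      obtain n where n: "w $ i = of_int n" using w unfolding integer_vector_def by (blast elim: Ints_cases)
      have "\<bar>real_of_int n\<bar> \<le> R" using w n by (metis (no_types, lifting) mem_Collect_eq)
      then have "- \<lceil>R\<rceil> \<le> n" "n \<le> \<lceil>R\<rceil>" by linarith+
      then show ?thesis unfolding n by (intro imageI) simp
    qed
    then have "(w $ 1, w $ 2) \<in> ?I \<times> ?I" by blast
    moreover have "w = ?f (w $ 1, w $ 2)" by (simp add: vec_eq_iff forall_2)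
    ultimately show "w \<in> ?f ` (?I \<times> ?I)" by (rule rev_image_eqI)
  qed
qed

text \<open>
  The case of equal weights. The bound depends on the vector only through its norm, also when the vector
  lies on an eigenline, where the form vanishes.
\<close>
lemma sail_depth_bounded_on_bounded_sets:
  assumes A: "MCRS_group \<A>" "u1 \<noteq> 0" "u2 \<noteq> 0"
      "has_eigenspaces \<A> (vec.span {complexify u1}) (vec.span {complexify u2})"
  obtains C :: nat where "\<And>v k. max_abs (complexify v) \<le> R \<Longrightarrow>
    v \<in> geometric_continued_fraction \<A> k \<Longrightarrow> k \<le> C"
proof -
  have D: "cross u1 u2 \<noteq> 0" by (rule has_eigenspaces_cross_nonzero[OF A(4,2,3)])
  define c where "c = (\<bar>u2 $ 1\<bar> + \<bar>u2 $ 2\<bar>) / \<bar>cross u1 u2\<bar> + (\<bar>u1 $ 1\<bar> + \<bar>u1 $ 2\<bar>) / \<bar>cross u1 u2\<bar>"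
  define r where "r = c * R + 1"
  define T where "T = {w. integer_vector w \<and> (\<forall>i. \<bar>w $ i\<bar> \<le> r * (\<bar>u1 $ 1\<bar> + \<bar>u1 $ 2\<bar> + \<bar>u2 $ 1\<bar> + \<bar>u2 $ 2\<bar>))}"
  have fin: "finite T" unfolding T_def by (rule finite_integer_vectors_bounded)
  show thesis
  proof (rule that)
    fix v k
    assume v: "max_abs (complexify v) \<le> R" "v \<in> geometric_continued_fraction \<A> k"
    then obtain K where K: "K \<in> eigencones \<A>" "v \<in> sail K k"
      by (auto simp: geometric_continued_fraction_def)
    obtain \<sigma> \<tau> where st: "\<bar>\<sigma>\<bar> = 1" "\<bar>\<tau>\<bar> = 1" "K = closed_cone (\<sigma> *\<^sub>R u1) (\<tau> *\<^sub>R u2)"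
      using eigencone_cases[OF A K(1)] by blast
    show "k \<le> card T"
    proof (rule sail_depth_le_card_coords[OF D st(1,2) K(2)[unfolded st(3)], of 1 1 r])
      have "\<bar>coord1 u1 u2 v\<bar> + \<bar>coord2 u1 u2 v\<bar> \<le> c * max_abs (complexify v)"
        using add_mono[OF abs_coord_le[of u1 u2 v]] by (simp add: c_def algebra_simps)
      also have "\<dots> \<le> c * R" using v(1) by (intro mult_left_mono) (simp_all add: c_def)
      finally show "1 * \<bar>coord1 u1 u2 v\<bar> + 1 * \<bar>coord2 u1 u2 v\<bar> < r" by (simp add: r_def)
      fix w assume w: "integer_vector w" "1 * \<bar>coord1 u1 u2 w\<bar> + 1 * \<bar>coord2 u1 u2 w\<bar> \<le> r"
      have c12: "\<bar>coord1 u1 u2 w\<bar> \<le> r" "\<bar>coord2 u1 u2 w\<bar> \<le> r" and r0: "0 \<le> r"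
        using w(2) by linarith+
      have "\<bar>w $ i\<bar> \<le> r * (\<bar>u1 $ 1\<bar> + \<bar>u1 $ 2\<bar> + \<bar>u2 $ 1\<bar> + \<bar>u2 $ 2\<bar>)" for i
      proof -
        have "w = coord1 u1 u2 w *\<^sub>R u1 + coord2 u1 u2 w *\<^sub>R u2"
          unfolding coord1_def coord2_def by (rule cross_basis_expansion[OF D])
        then have "w $ i = coord1 u1 u2 w * u1 $ i + coord2 u1 u2 w * u2 $ i"
          by (metis real_scaleR_def vector_add_component vector_scaleR_component)
        then have "\<bar>w $ i\<bar> \<le> \<bar>coord1 u1 u2 w\<bar> * \<bar>u1 $ i\<bar> + \<bar>coord2 u1 u2 w\<bar> * \<bar>u2 $ i\<bar>"
          by (metis abs_mult abs_triangle_ineq)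
        also have "\<dots> \<le> r * \<bar>u1 $ i\<bar> + r * \<bar>u2 $ i\<bar>"
          using c12 by (intro add_mono mult_right_mono) auto
        also have "\<dots> = r * (\<bar>u1 $ i\<bar> + \<bar>u2 $ i\<bar>)" by (simp add: algebra_simps)
        also have "\<dots> \<le> r * (\<bar>u1 $ 1\<bar> + \<bar>u1 $ 2\<bar> + \<bar>u2 $ 1\<bar> + \<bar>u2 $ 2\<bar>)"
          using r0 exhaust_2[of i] by (intro mult_left_mono) auto
        finally show ?thesis .
      qed
      then show "w \<in> T" using w(1) by (simp add: T_def)
    qed (simp_all add: fin)
  qed
qed

lemma MD_value_coords:
  assumes "cross u1 u2 \<noteq> 0"
  shows "MD_value u1 u2 w = - coord1 u1 u2 w * coord2 u1 u2 w * cross u1 u2"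
  using assms by (simp add: MD_value_def coord1_def coord2_def cross_flip[of u2 w] field_simps)

lemma coord_diff:
  "coord1 u1 u2 (w - w') = coord1 u1 u2 w - coord1 u1 u2 w'"
  "coord2 u1 u2 (w - w') = coord2 u1 u2 w - coord2 u1 u2 w'"
  by (simp_all add: coord1_def coord2_def cross_simps diff_divide_distrib)

text \<open>
  Cut the box into cells with sides \<open>a / m\<close> and \<open>b / m\<close>. If two integer points shared a cell, the form
  would take a value smaller than \<open>c\<close> at their difference. Flooring the scaled coordinates encodes the
  cell as a pair of integers in \<open>[-m, m]\<close>.
\<close>
lemma card_integer_box_le:
  assumes D: "cross u1 u2 \<noteq> 0"
    and bad: "\<And>w. integer_vector w \<Longrightarrow> w \<noteq> 0 \<Longrightarrow> c \<le> \<bar>MD_value u1 u2 w\<bar>"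
    and ab: "a > 0" "b > 0" and m: "m \<ge> (1::nat)" "a * b * \<bar>cross u1 u2\<bar> \<le> c * (real m)\<^sup>2"
  defines "T \<equiv> {w. integer_vector w \<and> \<bar>coord1 u1 u2 w\<bar> \<le> a \<and> \<bar>coord2 u1 u2 w\<bar> \<le> b}"
  shows "finite T" "card T \<le> (2 * m + 1)\<^sup>2"
proof -
  define f where "f w = (\<lfloor>m * coord1 u1 u2 w / a\<rfloor>, \<lfloor>m * coord2 u1 u2 w / b\<rfloor>)" for w
  have same_floor: "\<bar>x - y\<bar> < d / m" if "\<lfloor>m * x / d\<rfloor> = \<lfloor>m * y / d\<rfloor>" "d > 0" for x y d :: real
  proof -
    have "\<bar>m * x / d - m * y / d\<bar> < 1" using that(1) by linarith
    also have "m * x / d - m * y / d = (x - y) * (m / d)"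
      by (simp add: algebra_simps diff_divide_distrib)
    finally have "\<bar>x - y\<bar> * (m / d) < 1" using that(2) by (simp add: abs_mult)
    then show ?thesis using that(2) m(1) by (simp add: field_simps)
  qed
  have floor_range: "\<lfloor>m * x / d\<rfloor> \<in> {- int m..int m}" if "\<bar>x\<bar> \<le> d" "d > 0" for x d :: real
  proof -
    have "\<bar>x / d\<bar> \<le> 1" using that by (simp add: abs_divide divide_le_eq)
    then have "\<bar>real m * (x / d)\<bar> \<le> real m * 1"
      unfolding abs_mult by (intro mult_mono) auto
    then have "\<bar>real m * x / d\<bar> \<le> real m" by simp
    moreover have "\<lfloor>t\<rfloor> \<in> {- int m..int m}" if "\<bar>t\<bar> \<le> real m" for t :: real
    proof -
      have "- int m \<le> \<lfloor>t\<rfloor>" "\<lfloor>t\<rfloor> \<le> int m" using that by linarith+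
      then show ?thesis by simp
    qed
    ultimately show ?thesis by blast
  qed
  have inj: "inj_on f T"
  proof (rule inj_onI, rule ccontr)
    fix w w' assume w: "w \<in> T" "w' \<in> T" "f w = f w'" "w \<noteq> w'"
    have 1: "\<bar>coord1 u1 u2 (w - w')\<bar> < a / m" "\<bar>coord2 u1 u2 (w - w')\<bar> < b / m"
      using w(3) ab same_floor by (simp_all add: f_def coord_diff)
    have "c \<le> \<bar>MD_value u1 u2 (w - w')\<bar>"
      using w by (intro bad) (auto simp: T_def integer_vector_def)
    also have "\<dots> = \<bar>coord1 u1 u2 (w - w')\<bar> * \<bar>coord2 u1 u2 (w - w')\<bar> * \<bar>cross u1 u2\<bar>"
      by (simp add: MD_value_coords[OF D] abs_mult)
    also have "\<dots> < (a / m) * (b / m) * \<bar>cross u1 u2\<bar>"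
      using 1 D by (intro mult_strict_right_mono mult_strict_mono') auto
    also have "\<dots> = a * b * \<bar>cross u1 u2\<bar> / (real m)\<^sup>2" by (simp add: power2_eq_square)
    also have "\<dots> \<le> c" using m by (simp add: divide_le_eq)
    finally show False by simp
  qed
  let ?B = "{- int m..int m} \<times> {- int m..int m}"
  have im: "f ` T \<subseteq> ?B" using floor_range ab by (auto simp: f_def T_def simp del: atLeastAtMost_iff)
  show "finite T" using inj im by (metis finite_SigmaI finite_atLeastAtMost_int inj_on_finite)
  have "card T \<le> card ?B" using inj im by (rule card_inj_on_le) simp
  also have "\<dots> = (2 * m + 1)\<^sup>2" 
  proof -
    have "card {- int m..int m} = 2 * m + 1" by simp
    then show ?thesis by (simp only: card_cartesian_product power2_eq_square)
  qed
  finally show "card T \<le> (2 * m + 1)\<^sup>2" .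
qed

text \<open>
  If \<open>x\<close> and \<open>y\<close> are the absolute coordinates of \<open>v\<close>, the functional with weights \<open>1/x\<close> and \<open>1/y\<close>
  is at most 2 at \<open>v\<close>. The integer points of the cone where it is at most 3 lie in the box \<open>[-3x, 3x] \<times> [-3y, 3y]\<close>, whose size is
  measured by \<open>9 * x * y\<close>, that is, by \<open>9 * \<bar>\<Phi> v\<bar>\<close>, and not by \<open>v\<close> itself.
\<close>
lemma sail_depth_bounded_by_form:
  assumes A: "MCRS_group \<A>" "u1 \<noteq> 0" "u2 \<noteq> 0"
      "has_eigenspaces \<A> (vec.span {complexify u1}) (vec.span {complexify u2})"
    and c: "c > 0" and bad: "\<And>w. integer_vector w \<Longrightarrow> w \<noteq> 0 \<Longrightarrow> c \<le> \<bar>MD_value u1 u2 w\<bar>"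
  obtains C :: nat where "\<And>v k. integer_vector v \<Longrightarrow> v \<noteq> 0 \<Longrightarrow> \<bar>MD_value u1 u2 v\<bar> \<le> B \<Longrightarrow>
    v \<in> geometric_continued_fraction \<A> k \<Longrightarrow> k \<le> C"
proof -
  have D: "cross u1 u2 \<noteq> 0" by (rule has_eigenspaces_cross_nonzero[OF A(4,2,3)])
  define m where "m = nat \<lceil>9 * B / c\<rceil> + 1"
  have m: "m \<ge> 1" "9 * B / c \<le> real m" unfolding m_def by linarith+
  have "real m \<le> (real m)\<^sup>2" using m(1) by (simp add: power2_eq_square)
  have "9 * B = c * (9 * B / c)" using c by simp
  also have "\<dots> \<le> c * (real m)\<^sup>2"
    using m(2) \<open>real m \<le> (real m)\<^sup>2\<close> c by (intro mult_left_mono) linarith+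
  finally have m2: "9 * B \<le> c * (real m)\<^sup>2" .
  show thesis
  proof (rule that)
    fix v k
    assume v: "integer_vector v" "v \<noteq> 0" "\<bar>MD_value u1 u2 v\<bar> \<le> B" "v \<in> geometric_continued_fraction \<A> k"
    then obtain K where K: "K \<in> eigencones \<A>" "v \<in> sail K k"
      by (auto simp: geometric_continued_fraction_def)
    obtain \<sigma> \<tau> where st: "\<bar>\<sigma>\<bar> = 1" "\<bar>\<tau>\<bar> = 1" "K = closed_cone (\<sigma> *\<^sub>R u1) (\<tau> *\<^sub>R u2)"
      using eigencone_cases[OF A K(1)] by blast
    define x where "x = \<bar>coord1 u1 u2 v\<bar>"
    define y where "y = \<bar>coord2 u1 u2 v\<bar>"
    have Mv: "\<bar>MD_value u1 u2 v\<bar> = x * y * \<bar>cross u1 u2\<bar>"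
      by (simp add: MD_value_coords[OF D] abs_mult x_def y_def)
    have "0 < x * y * \<bar>cross u1 u2\<bar>" using bad[OF v(1,2)] c Mv by linarith
    then have xy: "0 < x" "0 < y" by (auto simp: x_def y_def zero_less_mult_iff)
    have "3 * x * (3 * y) * \<bar>cross u1 u2\<bar> \<le> c * (real m)\<^sup>2" using Mv v(3) m2 by simp
    note box = card_integer_box_le[OF D bad _ _ m(1) this]
    have "k \<le> card {w. integer_vector w \<and> \<bar>coord1 u1 u2 w\<bar> \<le> 3 * x \<and> \<bar>coord2 u1 u2 w\<bar> \<le> 3 * y}"
    proof (rule sail_depth_le_card_coords[OF D st(1,2) K(2)[unfolded st(3)], of "1/x" "1/y" 3])
      show "1 / x > 0" "1 / y > 0" using xy by simp_all
      show "1 / x * \<bar>coord1 u1 u2 v\<bar> + 1 / y * \<bar>coord2 u1 u2 v\<bar> < 3"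
        using xy by (simp add: x_def[symmetric] y_def[symmetric])
      show "finite {w. integer_vector w \<and> \<bar>coord1 u1 u2 w\<bar> \<le> 3 * x \<and> \<bar>coord2 u1 u2 w\<bar> \<le> 3 * y}"
        using box(1) xy by simp
      fix w assume w: "integer_vector w" "1 / x * \<bar>coord1 u1 u2 w\<bar> + 1 / y * \<bar>coord2 u1 u2 w\<bar> \<le> 3"
      have "0 \<le> 1 / x * \<bar>coord1 u1 u2 w\<bar>" "0 \<le> 1 / y * \<bar>coord2 u1 u2 w\<bar>" using xy by simp_all
      then have "1 / x * \<bar>coord1 u1 u2 w\<bar> \<le> 3" "1 / y * \<bar>coord2 u1 u2 w\<bar> \<le> 3" using w(2) by linarith+
      then show "w \<in> {w. integer_vector w \<and> \<bar>coord1 u1 u2 w\<bar> \<le> 3 * x \<and> \<bar>coord2 u1 u2 w\<bar> \<le> 3 * y}"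
        using w(1) xy by (simp add: divide_le_eq)
    qed
    also have "\<dots> \<le> (2 * m + 1)\<^sup>2" using box(2) xy by simp
    finally show "k \<le> (2 * m + 1)\<^sup>2" .
  qed
qed

section \<open>Integer matrices\<close>

text \<open>
  The form of an algebraic group is proportional to the form \<open>cross w (M w)\<close>, which has integer coefficients.
\<close>
lemma cross_image_diagonal:
  assumes D: "cross u1 u2 \<noteq> 0" and M: "M *v u1 = a *\<^sub>R u1" "M *v u2 = b *\<^sub>R u2"
  shows "cross w (M *v w) = (a - b) * MD_value u1 u2 w"
proof -
  have w: "w = coord1 u1 u2 w *\<^sub>R u1 + coord2 u1 u2 w *\<^sub>R u2"
    unfolding coord1_def coord2_def by (rule cross_basis_expansion[OF D])
  have "cross (x *\<^sub>R u1 + y *\<^sub>R u2) (M *v (x *\<^sub>R u1 + y *\<^sub>R u2)) = (b - a) * (x * y * cross u1 u2)" for x y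
    by (simp add: matrix_vector_right_distrib matrix_vector_mult_scaleR M cross_simps
        cross_flip[of u2 u1] algebra_simps)
  from this[of "coord1 u1 u2 w" "coord2 u1 u2 w"] show ?thesis
    unfolding MD_value_coords[OF D] w[symmetric] by (simp add: algebra_simps)
qed

lemma integer_matrix_vector:
  assumes "\<And>i j. M $ i $ j \<in> \<int>" "integer_vector w"
  shows "integer_vector (M *v w)"
  using assms by (auto simp: integer_vector_def matrix_vector_mult_def intro!: Ints_sum Ints_mult)

lemma integer_vector_cross: "integer_vector v \<Longrightarrow> integer_vector w \<Longrightarrow> cross v w \<in> \<int>"
  by (auto simp: integer_vector_def cross_def intro!: Ints_diff Ints_mult)

text \<open>
  If \<open>w\<close> is an integer eigenvector for \<open>a\<close>, then \<open>M - a\<close> maps every vector into the other eigenline. Since \<open>a\<close>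
  is the ratio of the \<open>i\<close>-th coordinates of \<open>M w\<close> and \<open>w\<close>, multiplying by \<open>w $ i\<close> clears the denominator.
\<close>
lemma integer_vector_on_other_line:
  assumes D: "cross u1 u2 \<noteq> 0" and M: "M *v u1 = a *\<^sub>R u1" "M *v u2 = b *\<^sub>R u2" "a \<noteq> b"
    and Z: "\<And>i j. M $ i $ j \<in> \<int>"
    and w: "integer_vector w" "w \<noteq> 0" "cross u1 w = 0"
  obtains w' where "integer_vector w'" "w' \<noteq> 0" "cross u2 w' = 0"
proof -
  have u: "u1 \<noteq> 0" "u2 \<noteq> 0" using D by (auto simp: cross_def)
  obtain t where t: "w = t *\<^sub>R u1" using w(3) u(1) by (rule cross_eq_0_parallel)
  then have t0: "t \<noteq> 0" using w(2) by auto
  have Mw: "M *v w = a *\<^sub>R w" by (simp add: t matrix_vector_mult_scaleR M)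
  obtain i where i: "w $ i \<noteq> 0" using w(2) by (auto simp: vec_eq_iff)
  \<comment> \<open>Any integer vector off the line of \<open>w\<close> would do; this one is orthogonal to \<open>w\<close>.\<close>
  define x :: "real^2" where "x = vector [- w $ 2, w $ 1]"
  have xZ: "integer_vector x" using w(1) by (simp add: integer_vector_def x_def forall_2)
  have "cross w x = (w $ 1)\<^sup>2 + (w $ 2)\<^sup>2" by (simp add: cross_def x_def power2_eq_square)
  also have "\<dots> \<noteq> 0" using w(2) by (auto simp: vec_eq_iff forall_2)
  finally have wx: "cross u1 x \<noteq> 0" by (simp add: t cross_simps)
  define w' where "w' = w $ i *\<^sub>R (M *v x) - (M *v w) $ i *\<^sub>R x"
  have "integer_vector w'"
    using integer_matrix_vector[OF Z w(1)] integer_matrix_vector[OF Z xZ] w(1) xZ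
    unfolding w'_def by (auto simp: integer_vector_def intro!: Ints_diff Ints_mult)
  moreover have "w' = (w $ i * coord2 u1 u2 x * (b - a)) *\<^sub>R u2"
  proof -
    have xe: "x = coord1 u1 u2 x *\<^sub>R u1 + coord2 u1 u2 x *\<^sub>R u2"
      unfolding coord1_def coord2_def by (rule cross_basis_expansion[OF D])
    have "w' = w $ i *\<^sub>R (M *v x - a *\<^sub>R x)"
      by (simp add: w'_def Mw algebra_simps)
    also have "M *v x - a *\<^sub>R x = (coord2 u1 u2 x * (b - a)) *\<^sub>R u2"
      by (subst (1 2) xe)
        (simp add: matrix_vector_right_distrib matrix_vector_mult_scaleR M algebra_simps)
    finally show ?thesis by simp
  qed
  moreover have "w $ i * coord2 u1 u2 x * (b - a) \<noteq> 0"
    using i wx D M(3) by (simp add: coord2_def)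
  ultimately show thesis
    using u(2) by (intro that[of w']) (simp_all add: cross_simps)
qed

text \<open>
  A nonzero integer has absolute value at least 1. The form can only vanish on the eigenlines.
\<close>
lemma integer_form_dichotomy:
  assumes D: "cross u1 u2 \<noteq> 0" and M: "M *v u1 = a *\<^sub>R u1" "M *v u2 = b *\<^sub>R u2" "a \<noteq> b"
    and Z: "\<And>i j. M $ i $ j \<in> \<int>"
  shows "(\<exists>c>0. \<forall>w. integer_vector w \<longrightarrow> w \<noteq> 0 \<longrightarrow> c \<le> \<bar>MD_value u1 u2 w\<bar>) \<or>
    (\<exists>w1 w2. integer_vector w1 \<and> w1 \<noteq> 0 \<and> cross u1 w1 = 0 \<and>
      integer_vector w2 \<and> w2 \<noteq> 0 \<and> cross u2 w2 = 0)"
proof (cases "\<exists>w. integer_vector w \<and> w \<noteq> 0 \<and> MD_value u1 u2 w = 0")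
  case True
  then obtain w where w: "integer_vector w" "w \<noteq> 0" "MD_value u1 u2 w = 0" by blast
  then consider "cross u1 w = 0" | "cross u2 w = 0" using D by (auto simp: MD_value_def)
  then show ?thesis
  proof cases
    case 1
    obtain w' where "integer_vector w'" "w' \<noteq> 0" "cross u2 w' = 0"
      using integer_vector_on_other_line[OF D M Z w(1,2) 1] .
    then show ?thesis using w 1 by blast
  next
    case 2
    have D': "cross u2 u1 \<noteq> 0" using D by (simp add: cross_flip[of u2])
    obtain w' where "integer_vector w'" "w' \<noteq> 0" "cross u1 w' = 0"
      using integer_vector_on_other_line[OF D' M(2,1) M(3)[symmetric] Z w(1,2) 2] .
    then show ?thesis using w 2 by blast
  qed
next
  case False
  have "1 / \<bar>a - b\<bar> \<le> \<bar>MD_value u1 u2 w\<bar>" if w: "integer_vector w" "w \<noteq> 0" for w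
  proof -
    have "MD_value u1 u2 w \<noteq> 0" using False w by blast
    then have "cross w (M *v w) \<noteq> 0" by (simp add: cross_image_diagonal[OF D M(1,2)] M(3))
    moreover have "cross w (M *v w) \<in> \<int>"
      using w(1) integer_matrix_vector[OF Z w(1)] by (rule integer_vector_cross)
    ultimately have "1 \<le> \<bar>cross w (M *v w)\<bar>" by (rule Ints_nonzero_abs_ge1[rotated])
    then show ?thesis
      using M(3) by (simp add: cross_image_diagonal[OF D M(1,2)] abs_mult divide_le_eq mult.commute)
  qed
  moreover have "1 / \<bar>a - b\<bar> > 0" using M(3) by simp
  ultimately show ?thesis by blast
qed


section \<open>Best approximations\<close>

lemma best_approximation_vectors:
  assumes "best_approximation \<A> N \<B>" "primitive (complexify v1)" "primitive (complexify v2)"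
    and hs: "has_eigenspaces \<B> (vec.span {complexify v1}) (vec.span {complexify v2})"
  shows "MCRS_group \<B>" "max_abs (complexify v1) \<le> real N" "max_abs (complexify v2) \<le> real N"
proof -
  show B: "MCRS_group \<B>" using assms(1) by (simp add: best_approximation_def Rat2_def)
  have "group_size \<B> \<le> real N" using assms(1) by (simp add: best_approximation_def)
  then show "max_abs (complexify v1) \<le> real N" "max_abs (complexify v2) \<le> real N"
    unfolding group_size_eq[OF B hs assms(2,3)] by simp_all
qed

text \<open>
  For large \<open>N\<close> the discrepancy is \<open>O(1/N\<^sup>2)\<close> while the eigenvectors have size at most \<open>N\<close>. For the remaining
  \<open>N\<close> the eigenvectors are bounded.
\<close>
lemma best_approximation_form_bounded:
  assumes A: "MCRS_group \<A>" "u1 \<noteq> 0" "u2 \<noteq> 0"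
      "has_eigenspaces \<A> (vec.span {complexify u1}) (vec.span {complexify u2})"
    and c: "c > 0" and bad: "\<And>w. integer_vector w \<Longrightarrow> w \<noteq> 0 \<Longrightarrow> c \<le> \<bar>MD_value u1 u2 w\<bar>"
  obtains B where "\<And>N \<B> v1 v2 v. N \<ge> 1 \<Longrightarrow> best_approximation \<A> N \<B> \<Longrightarrow>
    primitive (complexify v1) \<Longrightarrow> primitive (complexify v2) \<Longrightarrow>
    has_eigenspaces \<B> (vec.span {complexify v1}) (vec.span {complexify v2}) \<Longrightarrow>
    v = v1 \<or> v = v2 \<Longrightarrow> \<bar>MD_value u1 u2 v\<bar> \<le> B"
proof -
  have D: "cross u1 u2 \<noteq> 0" by (rule has_eigenspaces_cross_nonzero[OF A(4,2,3)])
  obtain K N0 where K: "K > 0" and approx: "\<And>N. N \<ge> N0 \<Longrightarrow>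
      \<exists>w1 w2. primitive (complexify w1) \<and> primitive (complexify w2) \<and>
      max_abs (complexify w1) \<le> real N \<and> max_abs (complexify w2) \<le> real N \<and> cross w1 w2 \<noteq> 0 \<and>
      max_abs (MD_form u1 u2 - MD_form w1 w2) \<le> K / (real N)\<^sup>2"
    using good_rational_approximation[OF D c bad] by blast
  define B where "B = max (3 * K) (3 * max_abs (MD_form u1 u2) * (real N0)\<^sup>2)"
  show thesis
  proof (rule that)
    fix N \<B> v1 v2 v
    assume N: "N \<ge> 1" and best: "best_approximation \<A> N \<B>"
      and v12: "primitive (complexify v1)" "primitive (complexify v2)"
      and hs: "has_eigenspaces \<B> (vec.span {complexify v1}) (vec.span {complexify v2})"
      and v: "v = v1 \<or> v = v2"
    note vec = best_approximation_vectors[OF best v12 hs]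
    have vN: "max_abs (complexify v) \<le> real N" using v vec by blast
    have sq: "(max_abs (complexify v))\<^sup>2 \<le> (real N)\<^sup>2"
      using vN max_abs_nonneg by (rule power_mono)
    show "\<bar>MD_value u1 u2 v\<bar> \<le> B"
    proof (cases "N \<ge> N0")
      case True
      obtain w1 w2 where w: "primitive (complexify w1)" "primitive (complexify w2)"
        "max_abs (complexify w1) \<le> real N" "max_abs (complexify w2) \<le> real N" "cross w1 w2 \<noteq> 0"
        and close: "max_abs (MD_form u1 u2 - MD_form w1 w2) \<le> K / (real N)\<^sup>2"
        using approx[OF True] by blast
      let ?G = "adapted_group w1 w2"
      have w0: "w1 \<noteq> 0" "w2 \<noteq> 0" using w(5) by (auto simp: cross_def)
      note G = adapted_group_MCRS[OF w(5)] adapted_group_eigenspaces[OF w(5)]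
      have "?G \<in> Rat2" by (rule MCRS_group_Rat2[OF G w(1,2)])
      moreover have "group_size ?G \<le> real N" using w(3,4) by (simp add: group_size_eq[OF G w(1,2)])
      ultimately have "discrepancy \<A> \<B> \<le> discrepancy \<A> ?G"
        using best by (simp add: best_approximation_def)
      also have "\<dots> \<le> K / (real N)\<^sup>2"
        using close by (simp add: discrepancy_eq[OF A G(1) w0 G(2)])
      finally have disc: "discrepancy \<A> \<B> \<le> K / (real N)\<^sup>2" .
      have v0: "v1 \<noteq> 0" "v2 \<noteq> 0" using v12 primitive_nonzero by force+
      have "\<bar>MD_value u1 u2 v\<bar> \<le> 3 * discrepancy \<A> \<B> * (max_abs (complexify v))\<^sup>2"
        by (rule MD_value_le_discrepancy[OF A vec(1) v0 hs v])
      also have "\<dots> \<le> 3 * (K / (real N)\<^sup>2) * (max_abs (complexify v))\<^sup>2"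
        using disc by (intro mult_right_mono) auto
      also have "\<dots> \<le> 3 * (K / (real N)\<^sup>2) * (real N)\<^sup>2"
        using sq K by (intro mult_left_mono) auto
      also have "\<dots> = 3 * K" using N by simp
      finally show ?thesis by (simp add: B_def)
    next
      case False
      have "\<bar>MD_value u1 u2 v\<bar> \<le> 3 * max_abs (MD_form u1 u2) * (max_abs (complexify v))\<^sup>2"
        by (rule MD_value_le)
      also have "\<dots> \<le> 3 * max_abs (MD_form u1 u2) * (real N0)\<^sup>2"
        using vN False by (intro mult_left_mono power_mono) (auto simp: max_abs_nonneg)
      finally show ?thesis by (simp add: B_def)
    qed
  qed
qed

text \<open>
  Once \<open>N\<close> reaches the size of a rational group, the group approximates itself with discrepancy 0. The form of
  \<open>\<A>\<close> then vanishes at \<open>v\<close>, which is therefore a primitive vector on an eigenline of \<open>\<A>\<close>.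
\<close>
lemma best_approximation_rational_bounded:
  assumes A: "MCRS_group \<A>"
    and hs: "has_eigenspaces \<A> (vec.span {complexify p1}) (vec.span {complexify p2})"
    and p: "primitive (complexify p1)" "primitive (complexify p2)"
    and best: "best_approximation \<A> N \<B>"
    and v12: "primitive (complexify v1)" "primitive (complexify v2)"
    and hsB: "has_eigenspaces \<B> (vec.span {complexify v1}) (vec.span {complexify v2})"
    and v: "v = v1 \<or> v = v2"
  shows "max_abs (complexify v) \<le> group_size \<A>"
proof (cases "group_size \<A> \<le> real N")
  case False
  then show ?thesis using best_approximation_vectors[OF best v12 hsB] v by auto
next
  case True
  have p0: "p1 \<noteq> 0" "p2 \<noteq> 0" using p primitive_nonzero by force+
  have v0: "v1 \<noteq> 0" "v2 \<noteq> 0" using v12 primitive_nonzero by force+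
  note B = best_approximation_vectors(1)[OF best v12 hsB]
  have D: "cross p1 p2 \<noteq> 0" by (rule has_eigenspaces_cross_nonzero[OF hs p0])
  have "\<A> \<in> Rat2" by (rule MCRS_group_Rat2[OF A hs p])
  then have "discrepancy \<A> \<B> \<le> discrepancy \<A> \<A>"
    using best True by (simp add: best_approximation_def)
  also have "\<dots> \<le> max_abs (0 :: complex^3)"
    unfolding discrepancy_eq[OF A p0 hs A p0 hs] by simp
  also have "max_abs (0 :: complex^3) = 0" by (simp add: max_abs_def)
  finally have disc: "discrepancy \<A> \<B> \<le> 0" .
  have "\<bar>MD_value p1 p2 v\<bar> \<le> 3 * discrepancy \<A> \<B> * (max_abs (complexify v))\<^sup>2"
    by (rule MD_value_le_discrepancy[OF A p0 hs B v0 hsB v])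
  also have "\<dots> \<le> 0" using disc by (simp add: mult_nonpos_nonneg)
  finally have "cross p1 v = 0 \<or> cross p2 v = 0" using D by (auto simp: MD_value_def)
  then obtain q t where q: "q = p1 \<or> q = p2" "v = t *\<^sub>R q"
    using cross_eq_0_parallel p0 by metis
  have "primitive (complexify v)" "primitive (complexify q)" using v v12 q(1) p by blast+
  then have "max_abs (complexify v) = max_abs (complexify q)"
    using q(2) complexify_scaleR primitive_max_abs_unique by metis
  then show ?thesis using q(1) by (auto simp: group_size_eq[OF A hs p])
qed

theorem theorem3p8:
  fixes \<A> :: "(real^2^2) set"
  assumes "MCRS_group \<A>" and "algebraic_group \<A>" and "hyperbolic \<A>"
  shows "\<exists>C::real. C > 0 \<and>
    (\<forall>(N::nat) \<A>\<^sub>N (v1::real^2) (v2::real^2) (k1::nat) (k2::nat).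
       N \<ge> 1 \<longrightarrow> best_approximation \<A> N \<A>\<^sub>N \<longrightarrow>
       primitive (complexify v1) \<longrightarrow> primitive (complexify v2) \<longrightarrow>
       has_eigenspaces \<A>\<^sub>N (vec.span {complexify v1}) (vec.span {complexify v2}) \<longrightarrow>
       k1 \<ge> 1 \<longrightarrow> k2 \<ge> 1 \<longrightarrow>
       v1 \<in> geometric_continued_fraction \<A> k1 \<longrightarrow>
       v2 \<in> geometric_continued_fraction \<A> k2 \<longrightarrow>
       real k1 < C \<and> real k2 < C)"
proof -
  obtain u1 u2 where u: "u1 \<noteq> 0" "u2 \<noteq> 0"
    and hs: "has_eigenspaces \<A> (vec.span {complexify u1}) (vec.span {complexify u2})"
    using hyperbolic_real_eigenspaces[OF assms(1,3)] .
  note A = assms(1) u hs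
  have D: "cross u1 u2 \<noteq> 0" by (rule has_eigenspaces_cross_nonzero[OF hs u])
  obtain M where M: "M \<in> \<A>" "regular M" "M \<in> GL2Z"
    using assms(2) by (auto simp: algebraic_group_def)
  obtain a b where ab: "M *v u1 = a *\<^sub>R u1" "M *v u2 = b *\<^sub>R u2" "a \<noteq> b"
    using real_eigenspaces_diagonalise[OF hs u M(1,2)] .
  have Z: "M $ i $ j \<in> \<int>" for i j using M(3) by (simp add: GL2Z_def)
  have "\<exists>C::nat. \<forall>N \<B> v1 v2 v k. N \<ge> 1 \<longrightarrow> best_approximation \<A> N \<B> \<longrightarrow>
      primitive (complexify v1) \<longrightarrow> primitive (complexify v2) \<longrightarrow>
      has_eigenspaces \<B> (vec.span {complexify v1}) (vec.span {complexify v2}) \<longrightarrow>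
      v = v1 \<or> v = v2 \<longrightarrow> v \<in> geometric_continued_fraction \<A> k \<longrightarrow> k \<le> C"
    using integer_form_dichotomy[OF D ab Z]
  proof (elim disjE exE conjE)
    fix c :: real assume c: "c > 0"
      and bad: "\<forall>w. integer_vector w \<longrightarrow> w \<noteq> 0 \<longrightarrow> c \<le> \<bar>MD_value u1 u2 w\<bar>"
    obtain B where B: "\<And>N \<B> v1 v2 v. N \<ge> 1 \<Longrightarrow> best_approximation \<A> N \<B> \<Longrightarrow>
        primitive (complexify v1) \<Longrightarrow> primitive (complexify v2) \<Longrightarrow>
        has_eigenspaces \<B> (vec.span {complexify v1}) (vec.span {complexify v2}) \<Longrightarrow>
        v = v1 \<or> v = v2 \<Longrightarrow> \<bar>MD_value u1 u2 v\<bar> \<le> B"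
      using best_approximation_form_bounded[OF A c] bad by metis
    obtain C where C: "\<And>v k. integer_vector v \<Longrightarrow> v \<noteq> 0 \<Longrightarrow> \<bar>MD_value u1 u2 v\<bar> \<le> B \<Longrightarrow>
        v \<in> geometric_continued_fraction \<A> k \<Longrightarrow> k \<le> C"
      using sail_depth_bounded_by_form[OF A c] bad by metis
    show ?thesis
    proof (intro exI[of _ C] allI impI)
      fix N \<B> v1 v2 v k
      assume *: "N \<ge> 1" "best_approximation \<A> N \<B>" "primitive (complexify v1)"
        "primitive (complexify v2)"
        "has_eigenspaces \<B> (vec.span {complexify v1}) (vec.span {complexify v2})" "v = v1 \<or> v = v2"
        and k: "v \<in> geometric_continued_fraction \<A> k"
      have prim: "primitive (complexify v)" using * by blast
      have "integer_vector v" "v \<noteq> 0"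
        using primitive_complexify_integral[OF prim] primitive_nonzero[OF prim]
        by (simp_all add: integer_vector_def)
      then show "k \<le> C" using B[OF *] k by (rule C)
    qed
  next
    fix w1 w2 assume w: "integer_vector w1" "w1 \<noteq> 0" "cross u1 w1 = 0"
      "integer_vector w2" "w2 \<noteq> 0" "cross u2 w2 = 0"
    have prim: "\<exists>p. primitive (complexify p) \<and> vec.span {complexify p} = vec.span {complexify u}"
      if iw: "integer_vector w" "w \<noteq> 0" "cross u w = 0" "u \<noteq> 0" for u w
    proof -
      obtain t p where p: "w = t *\<^sub>R p" "t \<noteq> 0" "primitive (complexify p)"
        using integer_vector_primitive_multiple[of w] iw(1,2) by (auto simp: integer_vector_def)
      have "p \<noteq> 0" using p iw(2) by auto
      moreover have "cross p u = 0" using iw(3) p by (simp add: cross_simps cross_flip[of p])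
      ultimately show ?thesis using p(3) span_complexify_eq_iff iw(4) by blast
    qed
    obtain p1 where p1: "primitive (complexify p1)" "vec.span {complexify p1} = vec.span {complexify u1}"
      using prim[OF w(1-3) u(1)] by blast
    obtain p2 where p2: "primitive (complexify p2)" "vec.span {complexify p2} = vec.span {complexify u2}"
      using prim[OF w(4-6) u(2)] by blast
    have hsp: "has_eigenspaces \<A> (vec.span {complexify p1}) (vec.span {complexify p2})"
      using hs p1 p2 by simp
    obtain C where C: "\<And>v k. max_abs (complexify v) \<le> group_size \<A> \<Longrightarrow>
        v \<in> geometric_continued_fraction \<A> k \<Longrightarrow> k \<le> C"
      using sail_depth_bounded_on_bounded_sets[OF A] by metis
    show ?thesis
      using C best_approximation_rational_bounded[OF assms(1) hsp p1(1) p2(1)]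
      by (intro exI[of _ C] allI impI) blast
  qed
  then obtain C :: nat where C: "\<And>N \<B> v1 v2 v k. N \<ge> 1 \<Longrightarrow> best_approximation \<A> N \<B> \<Longrightarrow>
      primitive (complexify v1) \<Longrightarrow> primitive (complexify v2) \<Longrightarrow>
      has_eigenspaces \<B> (vec.span {complexify v1}) (vec.span {complexify v2}) \<Longrightarrow>
      v = v1 \<or> v = v2 \<Longrightarrow> v \<in> geometric_continued_fraction \<A> k \<Longrightarrow> k \<le> C"
    by metis
  show ?thesis
  proof (intro exI[of _ "real C + 1"] conjI allI impI)
    show "real C + 1 > 0" by simp
    fix N \<A>\<^sub>N v1 v2 k1 k2
    assume *: "1 \<le> (N::nat)" "best_approximation \<A> N \<A>\<^sub>N" "primitive (complexify v1)"
      "primitive (complexify v2)"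
      "has_eigenspaces \<A>\<^sub>N (vec.span {complexify v1}) (vec.span {complexify v2})"
      and k: "v1 \<in> geometric_continued_fraction \<A> k1" "v2 \<in> geometric_continued_fraction \<A> k2"
    have "k1 \<le> C" using C[OF * _ k(1)] by blast
    then show "real k1 < real C + 1" by linarith
    have "k2 \<le> C" using C[OF * _ k(2)] by blast
    then show "real k2 < real C + 1" by linarith
  qed
qed

end
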